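(* Let $k$ be a field and $n\ge2$. The bigraded Hilbert--Poincaré series of the spaces $e_i\Pi(B_n)e_j$ (with $t$ recording path length and $s$ recording $x$-degree) are: for $i,j\ge2$, $$h_{e_i\Pi(B_n)e_j}(s,t)=\Big(t^{|i-j|}s^{|i-j|/2}+t^{i+j-2}s^{(i+j-4)/2}\Big)(1+s)\sum_{p=0}^{n-\max\{i,j\}}s^pt^{2p};$$ for $j\ge2$, $$h_{e_1\Pi(B_n)e_j}(s,t)=h_{e_j\Pi(B_n)e_1}(s,t)=t^{j-1}s^{(j-2)/2}(1+s)\sum_{p=0}^{n-j}s^pt^{2p};$$ and $$h_{e_1\Pi(B_n)e_1}(s,t)=\sum_{p=0}^{n-1}s^pt^{2p}.$$
   Context: Definition of $\Pi(B_n)$. It is the decorated preprojective algebra of the linear quiver with vertices $1,\dots,n$, decorated by $k$ at vertex $1$, by $S=k[x]/(x^2)$ at vertices $2,\dots,n$, by ${}_kS_S$ on the arrow $1\to2$ and by ${}_SS_S$ on the arrows $j\to j+1$, $j\ge2$ (signs in the relations may be dropped since the quiver is bipartite). Explicitly, $\Pi(B_n)$ is the $k$-algebra generated by orthogonal idempotents $e_1,\dots,e_n$ summing to $1$, arrows $\gamma_{i,i+1}\in e_i(\cdot)e_{i+1}$ and $\gamma_{i+1,i}\in e_{i+1}(\cdot)e_i$ for $1\le i\le n-1$, and elements $x_i\in e_i(\cdot)e_i$ for $2\le i\le n$ (products of paths read left to right), with relations - $x_i^2=0$ ($i\ge2$) and $x_i\gamma_{i,j}=\gamma_{i,j}x_j$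 for $i,j\ge2$, $|i-j|=1$; - $\gamma_{1,2}\gamma_{2,1}=0$; - $\gamma_{2,1}\gamma_{1,2}x_2+x_2\gamma_{2,1}\gamma_{1,2}+\gamma_{2,3}\gamma_{3,2}=0$ (the last term omitted if $n=2$); - $\gamma_{j,j+1}\gamma_{j+1,j}+\gamma_{j,j-1}\gamma_{j-1,j}=0$ for $3\le j\le n-1$; - $\gamma_{n,n-1}\gamma_{n-1,n}=0$ if $n\ge3$. Gradings. Path length: each $\gamma_{i,i\pm1}$ has length $1$, each $e_i$ and $x_i$ length $0$. $x$-degree: each $x_i$ has degree $1$; $\gamma_{1,2},\gamma_{2,1}$ have degree $0$; $\gamma_{i,i+1},\gamma_{i+1,i}$ with $i\ge2$ have degree $1/2$. The relations are homogeneous for both gradings. The bigraded Hilbert--Poincaré series is $\sum_{a,b}\dim_k(\text{length }a,\ x\text{-degree }b)\,t^as^b$. *)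

theory Defs
  imports
    "HOL-Algebra.Embedded_Algebras"
    "HOL-Algebra.QuotRing"
    "HOL-Library.Poly_Mapping"
    "HOL-Library.Product_Plus"
begin

section \<open>The free associative algebra\<close>

text \<open>
  The free monoid is written additively so that \<open>'a free_monoid \<Rightarrow>\<^sub>0 'k\<close>, with the convolution
  product of Poly\_Mapping, is the free associative \<open>'k\<close>-algebra on \<open>'a\<close>.
\<close>

datatype 'a free_monoid = Word (letters: "'a list")

instantiation free_monoid :: (type) monoid_add
begin

definition zero_free_monoid :: "'a free_monoid"
  where "0 = Word []"

definition plus_free_monoid :: "'a free_monoid \<Rightarrow> 'a free_monoid \<Rightarrow> 'a free_monoid"
  where "u + v = Word (letters u @ letters v)"

instance
  by standard (simp_all add: zero_free_monoid_def plus_free_monoid_def)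

end

type_synonym ('a, 'k) free_alg = "'a free_monoid \<Rightarrow>\<^sub>0 'k"

definition gen_elt :: "'a \<Rightarrow> ('a, 'k::zero_neq_one) free_alg"
  where "gen_elt a = Poly_Mapping.single (Word [a]) 1"

definition free_algebra :: "'a set \<Rightarrow> ('a, 'k::field) free_alg ring"
  where "free_algebra A =
    \<lparr>carrier = {f. \<forall>w\<in>Poly_Mapping.keys f. set (letters w) \<subseteq> A},
     mult = (*), one = 1, zero = 0, add = (+)\<rparr>"


section \<open>The algebra \<open>\<Pi>(B\<^sub>n)\<close>\<close>

text \<open>\<open>Vert i\<close>, \<open>Arr i j\<close> and \<open>Loop i\<close> stand for \<open>e\<^sub>i\<close>, \<open>\<gamma>\<^bsub>i,j\<^esub>\<close> and \<open>x\<^sub>i\<close>.\<close>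

datatype gen = Vert nat | Arr nat nat | Loop nat

definition adjacent :: "nat \<Rightarrow> nat \<Rightarrow> bool"
  where "adjacent i j \<longleftrightarrow> j = i + 1 \<or> i = j + 1"

definition gens :: "nat \<Rightarrow> gen set"
  where "gens n =
    Vert ` {1..n}
    \<union> {Arr i j | i j. i \<in> {1..n} \<and> j \<in> {1..n} \<and> adjacent i j}
    \<union> Loop ` {2..n}"

abbreviation e_elt :: "nat \<Rightarrow> (gen, 'k::field) free_alg" where "e_elt i \<equiv> gen_elt (Vert i)"
abbreviation g_elt :: "nat \<Rightarrow> nat \<Rightarrow> (gen, 'k::field) free_alg" where "g_elt i j \<equiv> gen_elt (Arr i j)"
abbreviation x_elt :: "nat \<Rightarrow> (gen, 'k::field) free_alg" where "x_elt i \<equiv> gen_elt (Loop i)"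

definition path_rels :: "nat \<Rightarrow> (gen, 'k::field) free_alg set"
  where "path_rels n =
    {e_elt i * e_elt j - (if i = j then e_elt i else 0) | i j. i \<in> {1..n} \<and> j \<in> {1..n}}
    \<union> {(\<Sum>i = 1..n. e_elt i) - 1}
    \<union> {e_elt i * g_elt i j - g_elt i j | i j. i \<in> {1..n} \<and> j \<in> {1..n} \<and> adjacent i j}
    \<union> {g_elt i j * e_elt j - g_elt i j | i j. i \<in> {1..n} \<and> j \<in> {1..n} \<and> adjacent i j}
    \<union> {e_elt i * x_elt i - x_elt i | i. i \<in> {2..n}}
    \<union> {x_elt i * e_elt i - x_elt i | i. i \<in> {2..n}}"

definition preproj_rels :: "nat \<Rightarrow> (gen, 'k::field) free_alg set"
  where "preproj_rels n =
    {x_elt i * x_elt i | i. i \<in> {2..n}}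
    \<union> {x_elt i * g_elt i j - g_elt i j * x_elt j | i j. i \<in> {2..n} \<and> j \<in> {2..n} \<and> adjacent i j}
    \<union> {g_elt 1 2 * g_elt 2 1}
    \<union> {g_elt 2 1 * g_elt 1 2 * x_elt 2 + x_elt 2 * g_elt 2 1 * g_elt 1 2
         + (if n \<ge> 3 then g_elt 2 3 * g_elt 3 2 else 0)}
    \<union> {g_elt j (j+1) * g_elt (j+1) j + g_elt j (j-1) * g_elt (j-1) j | j. 3 \<le> j \<and> j \<le> n - 1}
    \<union> (if n \<ge> 3 then {g_elt n (n-1) * g_elt (n-1) n} else {})"

definition rel_ideal :: "nat \<Rightarrow> (gen, 'k::field) free_alg set"
  where "rel_ideal n = Idl\<^bsub>free_algebra (gens n)\<^esub> (path_rels n \<union> preproj_rels n)"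

type_synonym 'k Pi_elt = "(gen, 'k) free_alg set"

definition Pi_B :: "nat \<Rightarrow> 'k::field Pi_elt ring"
  where "Pi_B n = free_algebra (gens n) Quot rel_ideal n"

definition Pi_class :: "nat \<Rightarrow> (gen, 'k::field) free_alg \<Rightarrow> 'k Pi_elt"
  where "Pi_class n f = rel_ideal n +>\<^bsub>free_algebra (gens n)\<^esub> f"

definition Pi_scalars :: "nat \<Rightarrow> 'k::field Pi_elt set"
  where "Pi_scalars n = {Pi_class n (Poly_Mapping.single 0 c) | c. True}"

definition corner :: "nat \<Rightarrow> nat \<Rightarrow> nat \<Rightarrow> 'k::field Pi_elt set"
  where "corner n i j =
    {Pi_class n (e_elt i) \<otimes>\<^bsub>Pi_B n\<^esub> y \<otimes>\<^bsub>Pi_B n\<^esub> Pi_class n (e_elt j) | y. y \<in> carrier (Pi_B n)}"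


section \<open>Bigrading and Hilbert--Poincare series\<close>

text \<open>Bidegrees are pairs (path length, \<open>x\<close>-degree).\<close>

fun gen_bideg :: "gen \<Rightarrow> nat \<times> rat" where
  "gen_bideg (Vert i) = (0, 0)"
| "gen_bideg (Arr i j) = (1, if i = 1 \<or> j = 1 then 0 else 1/2)"
| "gen_bideg (Loop i) = (0, 1)"

definition word_bideg :: "gen free_monoid \<Rightarrow> nat \<times> rat"
  where "word_bideg w = (\<Sum>a\<leftarrow>letters w. gen_bideg a)"

definition Pi_homog :: "nat \<Rightarrow> nat \<times> rat \<Rightarrow> 'k::field Pi_elt set"
  where "Pi_homog n d =
    {Pi_class n f | f. f \<in> carrier (free_algebra (gens n)) \<and>
       (\<forall>w\<in>Poly_Mapping.keys f. word_bideg w = d)}"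

text \<open>
  A bigraded series \<open>\<Sum> h(a,b) t\<^sup>a s\<^sup>b\<close> is represented by its coefficient function \<open>h\<close>. The predicate
  includes that every bihomogeneous part of \<open>V\<close> is finite-dimensional, since \<open>ring.dimension\<close>
  only relates a finite-dimensional space to its dimension.
\<close>

definition has_hilbert_series :: "nat \<Rightarrow> 'k::field Pi_elt set \<Rightarrow> (nat \<times> rat \<Rightarrow> nat) \<Rightarrow> bool"
  where "has_hilbert_series n V h \<longleftrightarrow>
    (\<forall>d. ring.dimension (Pi_B n) (h d) (Pi_scalars n) (V \<inter> Pi_homog n d))"

text \<open>
  Polynomials in \<open>t\<close> and in rational powers of \<open>s\<close> are elements of the monoid algebra
  \<open>(nat \<times> rat) \<Rightarrow>\<^sub>0 nat\<close>.
\<close>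

type_synonym ts_poly = "(nat \<times> rat) \<Rightarrow>\<^sub>0 nat"

definition t_pow :: "nat \<Rightarrow> ts_poly"
  where "t_pow a = Poly_Mapping.single (a, 0) 1"

definition s_pow :: "rat \<Rightarrow> ts_poly"
  where "s_pow b = Poly_Mapping.single (0, b) 1"


section \<open>Well-formedness\<close>

lemma free_algebra_simps [simp]:
  "mult (free_algebra A) = ((*) :: ('a, 'k::field) free_alg \<Rightarrow> _)"
  "add (free_algebra A) = ((+) :: ('a, 'k) free_alg \<Rightarrow> _)"
  "one (free_algebra A) = (1 :: ('a, 'k) free_alg)"
  "zero (free_algebra A) = (0 :: ('a, 'k) free_alg)"
  by (simp_all add: free_algebra_def)

lemma mem_carrier_free_algebra:
  "f \<in> carrier (free_algebra A) \<longleftrightarrow> (\<forall>w\<in>Poly_Mapping.keys f. set (letters w) \<subseteq> A)"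
  by (simp add: free_algebra_def)

lemma free_algebra_ring: "ring (free_algebra A :: ('a, 'k::field) free_alg ring)"
proof -
  have plus: "set (letters w) \<subseteq> A"
    if "\<forall>w\<in>Poly_Mapping.keys f. set (letters w) \<subseteq> A" "\<forall>w\<in>Poly_Mapping.keys h. set (letters w) \<subseteq> A"
      and "w \<in> Poly_Mapping.keys (f + h)" for f h :: "('a, 'k) free_alg" and w
    using that Poly_Mapping.keys_add[of f h] by blast
  have mult: "set (letters w) \<subseteq> A"
    if "\<forall>w\<in>Poly_Mapping.keys f. set (letters w) \<subseteq> A" "\<forall>w\<in>Poly_Mapping.keys h. set (letters w) \<subseteq> A"
      and w: "w \<in> Poly_Mapping.keys (f * h)" for f h :: "('a, 'k) free_alg" and w
  proof -
    obtain u v where "w = u + v" "u \<in> Poly_Mapping.keys f" "v \<in> Poly_Mapping.keys h"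
      using keys_mult[of f h] w by blast
    then show ?thesis
      using that(1,2) by (fastforce simp: plus_free_monoid_def)
  qed
  show ?thesis
  proof (intro ringI abelian_groupI monoidI)
    show "\<exists>y\<in>carrier (free_algebra A). y \<oplus>\<^bsub>free_algebra A\<^esub> f = \<zero>\<^bsub>free_algebra A\<^esub>"
      if "f \<in> carrier (free_algebra A)" for f :: "('a, 'k) free_alg"
      using that by (intro bexI[of _ "- f"]) (auto simp: mem_carrier_free_algebra)
    show "f \<oplus>\<^bsub>free_algebra A\<^esub> h \<in> carrier (free_algebra A)"
      if "f \<in> carrier (free_algebra A)" "h \<in> carrier (free_algebra A)" for f h :: "('a, 'k) free_alg"
      using that plus[of f h] by (simp add: mem_carrier_free_algebra)
    show "f \<otimes>\<^bsub>free_algebra A\<^esub> h \<in> carrier (free_algebra A)"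
      if "f \<in> carrier (free_algebra A)" "h \<in> carrier (free_algebra A)" for f h :: "('a, 'k) free_alg"
      using that mult[of f h] by (simp add: mem_carrier_free_algebra)
  qed (simp_all add: mem_carrier_free_algebra zero_free_monoid_def algebra_simps)
qed

lemma rels_carrier:
  assumes "n \<ge> 2"
  shows "path_rels n \<union> preproj_rels n
    \<subseteq> carrier (free_algebra (gens n) :: (gen, 'k::field) free_alg ring)"
proof -
  define C where "C = carrier (free_algebra (gens n) :: (gen, 'k) free_alg ring)"
  have add: "a + b \<in> C" if "a \<in> C" "b \<in> C" for a b
    using ring.ring_simprules(1)[OF free_algebra_ring, of a "gens n" b] that
    by (simp add: C_def)
  have mult: "a * b \<in> C" if "a \<in> C" "b \<in> C" for a b
    using ring.ring_simprules(5)[OF free_algebra_ring, of a "gens n" b] that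
    by (simp add: C_def)
  have uminus: "- a \<in> C" if "a \<in> C" for a
    using that by (simp add: C_def mem_carrier_free_algebra)
  have diff: "a - b \<in> C" if "a \<in> C" "b \<in> C" for a b
    using add[of a "- b"] uminus that by simp
  have zero: "0 \<in> C" and one: "1 \<in> C"
    by (auto simp: C_def mem_carrier_free_algebra zero_free_monoid_def)
  have gen: "gen_elt a \<in> C" if "a \<in> gens n" for a
    using that by (simp add: C_def mem_carrier_free_algebra gen_elt_def)
  have e: "e_elt i \<in> C" if "i \<in> {1..n}" for i
    using that by (intro gen) (simp add: gens_def)
  have x: "x_elt i \<in> C" if "i \<in> {2..n}" for i
    using that by (intro gen) (simp add: gens_def)
  have g: "g_elt i j \<in> C" if "i \<in> {1..n}" "j \<in> {1..n}" "adjacent i j" for i j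
    using that by (intro gen) (simp add: gens_def)
  have sum: "(\<Sum>i\<in>I. e_elt i) \<in> C" if "I \<subseteq> {1..n}" for I
    using finite_subset[OF that finite_atLeastAtMost] that
    by (induction I rule: finite_induct) (auto intro!: zero add e)
  show ?thesis
    unfolding C_def[symmetric] path_rels_def preproj_rels_def
    using assms
    by (auto intro!: add mult diff zero one e x g sum simp: adjacent_def)
qed

lemma rel_ideal_ideal:
  assumes "n \<ge> 2"
  shows "ideal (rel_ideal n) (free_algebra (gens n) :: (gen, 'k::field) free_alg ring)"
  unfolding rel_ideal_def
  by (rule ring.genideal_ideal[OF free_algebra_ring rels_carrier[OF assms]])

lemma Pi_B_ring:
  assumes "n \<ge> 2"
  shows "ring (Pi_B n :: 'k::field Pi_elt ring)"
  unfolding Pi_B_def by (rule ideal.quotient_is_ring[OF rel_ideal_ideal[OF assms]])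

end

(*
  The signs in the relations are absorbed into the downward arrows h (j+1) j. Every vertex then
  carries a loop c j (namely c 1 = h 1 2 x 2 h 2 1 and c j = h j (j+1) h (j+1) j for j >= 2), and
  these loops together form a central element. Every path reduces to a monomial consisting of a
  path from i to j that is either monotone or makes one detour through the vertex 1, followed by an
  optional x and a power of c j; such a monomial vanishes as soon as the exponent of c j exceeds
  n - max i j. Right multiplication by a generator sends a surviving monomial to a signed sum of at
  most two of them, and these formulas define a representation of the algebra, so that the
  surviving monomials are linearly independent. Sorting them by bidegree gives the series.
*)
theory Submission
  imports Defs
begin

section \<open>Consequences of the relations\<close>

text \<open>The difficulty sits at the vertex 2. The round trip \<open>h 2 1 \<otimes> h 1 2\<close>
  need not commute with \<open>x 2\<close>, and the relation there fixes only the sum of the two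
  orders, which is \<open>c 2\<close>. Monomials are chosen with the nilpotent after the path and
  the loop power last, so the order with \<open>x 2\<close> in front must be rewritten as
  \<open>c 2\<close> minus the other order. This is the only product with two terms. The shape of
  \<open>c 1\<close> is then forced: since \<open>h 1 2 \<otimes> h 2 1\<close> vanishes,
  \<open>h 1 2 \<otimes> x 2 \<otimes> h 2 1\<close> is what \<open>c 2\<close> becomes when it
  slides along an arrow to or from 1.

  Confluence of the reduction is never examined. The multiplication table is applied to functions on
  basis indices with values in an arbitrary abelian group. Values in the free algebra give spanning,
  values in the field give a representation killing the relations, and naturality under additive
  maps identifies the coefficients of the two. Letting a monomial act from the index of the
  idempotent at its source reaches the index of that monomial and no other, so these coefficients
  are dual to the monomials. The table respects source and bidegree, hence so do the
  coefficients.\<close>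

declare One_nat_def [simp del]

text \<open>
  The arrows \<open>h i j\<close> are \<open>\<gamma>\<^bsub>i,j\<^esub>\<close> up to sign, and \<open>P i j\<close> is the monotone path from \<open>i\<close> to \<open>j\<close>.
  Generators with indices out of range are zero, so that the relation at the vertex \<open>n\<close> is the
  instance \<open>j = n\<close> of \<open>rel_j\<close>.
\<close>

locale B_relations = ring R for R (structure) +
  fixes n :: nat and e x :: "nat \<Rightarrow> 'a" and h P :: "nat \<Rightarrow> nat \<Rightarrow> 'a"
  assumes n2: "2 \<le> n"
    and closed [simp]: "e i \<in> carrier R" "x i \<in> carrier R" "h i j \<in> carrier R" "P i j \<in> carrier R"
    and e_e: "e i \<otimes> e j = (if i = j then e i else \<zero>)"
    and e_h: "e i \<otimes> h i j = h i j" and h_e: "h i j \<otimes> e j = h i j"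
    and e_x: "e i \<otimes> x i = x i" and x_e: "x i \<otimes> e i = x i"
    and x_x: "x i \<otimes> x i = \<zero>"
    and x_h: "2 \<le> i \<Longrightarrow> 2 \<le> j \<Longrightarrow> x i \<otimes> h i j = h i j \<otimes> x j"
    and h_12_21: "h 1 2 \<otimes> h 2 1 = \<zero>"
    and rel_2: "h 2 1 \<otimes> h 1 2 \<otimes> x 2 \<oplus> x 2 \<otimes> h 2 1 \<otimes> h 1 2 = h 2 3 \<otimes> h 3 2"
    and rel_j: "3 \<le> j \<Longrightarrow> h j (Suc j) \<otimes> h (Suc j) j = h j (j - 1) \<otimes> h (j - 1) j"
    and h_0: "\<not> adjacent i j \<or> i = 0 \<or> j = 0 \<or> n < i \<or> n < j \<Longrightarrow> h i j = \<zero>"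
    and P_refl: "P i i = e i"
    and P_up: "i \<le> j \<Longrightarrow> P i (Suc j) = P i j \<otimes> h j (Suc j)"
    and P_down: "j < i \<Longrightarrow> P i j = P i (Suc j) \<otimes> h (Suc j) j"
begin

section \<open>The loops \<open>c j\<close> and their centrality\<close>

definition c :: "nat \<Rightarrow> 'a"
  where "c j = (if j = 1 then h 1 2 \<otimes> x 2 \<otimes> h 2 1 else h j (Suc j) \<otimes> h (Suc j) j)"

lemma c_closed [simp]: "c j \<in> carrier R"
  by (simp add: c_def)

lemma c_1: "c 1 = h 1 2 \<otimes> x 2 \<otimes> h 2 1"
  by (simp add: c_def)

lemma c_2: "c 2 = h 2 1 \<otimes> h 1 2 \<otimes> x 2 \<oplus> x 2 \<otimes> h 2 1 \<otimes> h 1 2"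
  using rel_2 by (simp add: c_def numeral_eq_Suc)

lemma c_up: "2 \<le> j \<Longrightarrow> c j = h j (Suc j) \<otimes> h (Suc j) j"
  by (simp add: c_def)

text \<open>The vertex \<open>Suc j\<close> is at least 3, and there the relation identifies the
  upward round trip with the downward one.\<close>

lemma c_down: "2 \<le> j \<Longrightarrow> c (Suc j) = h (Suc j) j \<otimes> h j (Suc j)"
  using rel_j[of "Suc j"] by (simp add: c_def)

lemma c_e: "c j \<otimes> e j = c j" and e_c: "e j \<otimes> c j = c j"
  by (auto simp: c_def m_assoc h_e) (simp_all flip: m_assoc add: e_h)

text \<open>One summand of \<open>c 2\<close> dies because it begins with \<open>h 2 1\<close>; what
  survives is \<open>c 1 \<otimes> h 1 2\<close>.\<close>

lemma h_12_c: "h 1 2 \<otimes> c 2 = h 1 2 \<otimes> x 2 \<otimes> h 2 1 \<otimes> h 1 2"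
proof -
  have "h 1 2 \<otimes> c 2 = (h 1 2 \<otimes> h 2 1) \<otimes> h 1 2 \<otimes> x 2 \<oplus> h 1 2 \<otimes> x 2 \<otimes> h 2 1 \<otimes> h 1 2"
    unfolding c_2 by (simp add: r_distr m_assoc)
  then show ?thesis by (simp only: h_12_21) simp
qed

lemma c_h_21: "c 2 \<otimes> h 2 1 = h 2 1 \<otimes> h 1 2 \<otimes> x 2 \<otimes> h 2 1"
proof -
  have "c 2 \<otimes> h 2 1 = h 2 1 \<otimes> h 1 2 \<otimes> x 2 \<otimes> h 2 1 \<oplus> x 2 \<otimes> h 2 1 \<otimes> (h 1 2 \<otimes> h 2 1)"
    unfolding c_2 by (simp add: l_distr m_assoc)
  then show ?thesis by (simp only: h_12_21) simp
qed

lemma c_h_up: "1 \<le> j \<Longrightarrow> c j \<otimes> h j (Suc j) = h j (Suc j) \<otimes> c (Suc j)"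
proof (cases "j = 1")
  case True
  then show ?thesis using h_12_c by (simp add: c_1 m_assoc Suc_1)
next
  case False
  moreover assume "1 \<le> j"
  ultimately show ?thesis by (simp add: c_up[of j] c_down[of j] m_assoc)
qed

lemma c_h_down: "1 \<le> j \<Longrightarrow> c (Suc j) \<otimes> h (Suc j) j = h (Suc j) j \<otimes> c j"
proof (cases "j = 1")
  case True
  then show ?thesis using c_h_21 by (simp add: c_1 m_assoc Suc_1)
next
  case False
  moreover assume "1 \<le> j"
  ultimately show ?thesis by (simp add: c_up[of j] c_down[of j] m_assoc)
qed

text \<open>Arrows out of range vanish, so this form without side conditions can be used freely in
  inductions along paths.\<close>

lemma c_h: "c i \<otimes> h i j = h i j \<otimes> c j"
proof (cases "adjacent i j \<and> 1 \<le> i \<and> 1 \<le> j")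
  case True
  then show ?thesis using c_h_up[of i] c_h_down[of j] by (auto simp: adjacent_def simp flip: Suc_eq_plus1)
next
  case False
  then have "h i j = \<zero>" by (intro h_0) auto
  then show ?thesis by simp
qed

lemma c_x: "2 \<le> j \<Longrightarrow> c j \<otimes> x j = x j \<otimes> c j"
  by (simp add: c_up m_assoc x_h[of "Suc j" j, symmetric]) (simp flip: m_assoc add: x_h[of j])

lemma pow_comm:
  assumes "a \<otimes> z = z \<otimes> b" "a \<in> carrier R" "b \<in> carrier R" "z \<in> carrier R"
  shows "a [^] (p::nat) \<otimes> z = z \<otimes> b [^] p"
proof (induction p)
  case (Suc p)
  have "a [^] Suc p \<otimes> z = a [^] p \<otimes> (a \<otimes> z)" using assms by (simp add: m_assoc)
  also have "\<dots> = (a [^] p \<otimes> z) \<otimes> b" using assms by (simp add: m_assoc)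
  also have "\<dots> = z \<otimes> b [^] Suc p" using assms Suc by (simp add: m_assoc)
  finally show ?case .
qed (use assms in simp)

lemma pow_c: "c j [^] (p::nat) \<otimes> c j = c j \<otimes> c j [^] p"
  by (rule pow_comm) simp_all

lemmas pow_h = pow_comm[OF c_h c_closed c_closed closed(3)]
lemmas pow_x = pow_comm[OF c_x c_closed c_closed closed(2)]

lemma pow_e: "c j [^] (p::nat) \<otimes> e j = e j \<otimes> c j [^] p"
  by (rule pow_comm) (simp_all add: c_e e_c)

lemma P_c: "1 \<le> i \<Longrightarrow> 1 \<le> j \<Longrightarrow> c i [^] (p::nat) \<otimes> P i j = P i j \<otimes> c j [^] p"
proof -
  have up: "c i [^] p \<otimes> P i (i + m) = P i (i + m) \<otimes> c (i + m) [^] p" for m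
  proof (induction m)
    case (Suc m)
    then show ?case
      by (simp add: P_up) (metis (no_types) pow_h m_assoc closed(3,4) c_closed nat_pow_closed)
  qed (simp add: P_refl pow_e)
  have down: "c i [^] p \<otimes> P i (i - m) = P i (i - m) \<otimes> c (i - m) [^] p" for m
  proof (induction m)
    case (Suc m)
    show ?case
    proof (cases "i \<le> m")
      case False
      then have "P i (i - Suc m) = P i (i - m) \<otimes> h (i - m) (i - Suc m)"
        using P_down[of "i - Suc m" i] by (simp add: Suc_diff_Suc)
      then show ?thesis
        using Suc by simp (metis (no_types) pow_h m_assoc closed(3,4) c_closed nat_pow_closed)
    qed (use Suc in simp)
  qed (simp add: P_refl pow_e)
  show ?thesis
    using up[of "j - i"] down[of "i - j"] by (cases "i \<le> j") auto
qed

lemma P_e: "P i j \<otimes> e j = P i j"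
proof (cases "i < j")
  case True
  then show ?thesis by (cases j) (simp_all add: P_up m_assoc h_e)
next
  case False
  then show ?thesis by (cases "i = j") (simp_all add: P_refl e_e P_down m_assoc h_e)
qed

text \<open>Peeling off one round trip turns \<open>c j [^] Suc k\<close> into a product containing
  the \<open>k\<close>-th power of the loop one vertex higher. Eventually the path has to leave the
  vertex \<open>n\<close> upwards, where the arrow is zero.\<close>

lemma c_nilpotent: "1 \<le> j \<Longrightarrow> n < j + k \<Longrightarrow> 1 \<le> k \<Longrightarrow> c j [^] k = \<zero>"
proof (induction k arbitrary: j)
  case (Suc k)
  have *: "c j [^] Suc k = c j \<otimes> c j [^] k" for j by (simp add: pow_c)
  show ?case
  proof (cases "j = 1")
    case True
    \<comment> \<open>\<open>n < 1 + Suc k\<close> and \<open>2 \<le> n\<close> force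
      \<open>1 \<le> k\<close>, as the induction hypothesis requires.\<close>
    then have "c (Suc 1) [^] k = \<zero>" using Suc n2 by (intro Suc.IH) auto
    then have "c 2 [^] k \<otimes> h 2 1 = \<zero>" by (simp add: Suc_1)
    then have "h 2 1 \<otimes> c 1 [^] k = \<zero>" by (simp only: pow_h)
    then show ?thesis
      unfolding * True by (simp add: c_1 m_assoc)
  next
    case False
    then have j: "2 \<le> j" using Suc by simp
    have "h j (Suc j) \<otimes> h (Suc j) j \<otimes> c j [^] k = h j (Suc j) \<otimes> c (Suc j) [^] k \<otimes> h (Suc j) j"
      by (simp add: m_assoc pow_h)
    also have "\<dots> = \<zero>"
    proof (cases "k = 0")
      case True
      then have "h j (Suc j) = \<zero>" using Suc by (intro h_0) auto
      then show ?thesis by simp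
    next
      case False
      then have "c (Suc j) [^] k = \<zero>" using Suc by (intro Suc.IH) auto
      then show ?thesis by simp
    qed
    finally show ?thesis unfolding * c_up[OF j, symmetric] .
  qed
qed simp

section \<open>Standard monomials and their products with generators\<close>

definition X :: "nat \<Rightarrow> bool \<Rightarrow> 'a"
  where "X j \<epsilon> = (if \<epsilon> then x j else \<one>)"

text \<open>At \<open>j = 1\<close> the nilpotent sits one step earlier, at the vertex 2; without it
  the path would already be a detour. Accordingly \<open>shape\<close> later fixes the flag to
  \<open>True\<close> there.\<close>

definition WD :: "nat \<Rightarrow> nat \<Rightarrow> bool \<Rightarrow> nat \<Rightarrow> 'a"
  where "WD i j \<epsilon> p = (if j = 1 then P i 2 \<otimes> x 2 \<otimes> h 2 1 else P i j \<otimes> X j \<epsilon>) \<otimes> c j [^] p"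

definition WU :: "nat \<Rightarrow> nat \<Rightarrow> bool \<Rightarrow> nat \<Rightarrow> 'a"
  where "WU i j \<epsilon> p = P i 1 \<otimes> P 1 j \<otimes> X j \<epsilon> \<otimes> c j [^] p"

lemma X_closed [simp]: "X j \<epsilon> \<in> carrier R"
  by (simp add: X_def)

lemma W_closed [simp]: "WD i j \<epsilon> p \<in> carrier R" "WU i j \<epsilon> p \<in> carrier R"
  by (simp_all add: WD_def WU_def)

lemma X_e: "X j \<epsilon> \<otimes> e j = e j \<otimes> X j \<epsilon>"
  by (simp add: X_def e_x x_e)

lemma X_h: "2 \<le> j \<Longrightarrow> 2 \<le> k \<Longrightarrow> X j \<epsilon> \<otimes> h j k = h j k \<otimes> X k \<epsilon>"
  by (simp add: X_def x_h)

lemma X_c: "2 \<le> j \<Longrightarrow> X j \<epsilon> \<otimes> c j [^] (p::nat) = c j [^] p \<otimes> X j \<epsilon>"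
  by (simp add: X_def pow_x)

lemma WD_e: "WD i j \<epsilon> p \<otimes> e j = WD i j \<epsilon> p"
  by (simp add: WD_def m_assoc pow_e)
    (metis (no_types) P_e X_e h_e m_assoc closed X_closed c_closed nat_pow_closed m_closed One_nat_def)

lemma WU_e: "WU i j \<epsilon> p \<otimes> e j = WU i j \<epsilon> p"
  by (simp add: WU_def m_assoc pow_e)
    (metis (no_types) P_e X_e m_assoc closed X_closed c_closed nat_pow_closed m_closed)

lemma W_e_other:
  assumes "j \<noteq> k"
  shows "WD i j \<epsilon> p \<otimes> e k = \<zero>" "WU i j \<epsilon> p \<otimes> e k = \<zero>"
proof -
  have "WD i j \<epsilon> p \<otimes> e k = WD i j \<epsilon> p \<otimes> (e j \<otimes> e k)"
    by (simp add: WD_e flip: m_assoc)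
  then show "WD i j \<epsilon> p \<otimes> e k = \<zero>" using assms by (simp add: e_e)
  have "WU i j \<epsilon> p \<otimes> e k = WU i j \<epsilon> p \<otimes> (e j \<otimes> e k)"
    by (simp add: WU_e flip: m_assoc)
  then show "WU i j \<epsilon> p \<otimes> e k = \<zero>" using assms by (simp add: e_e)
qed

lemma W_other:
  assumes "j \<noteq> k" "e k \<otimes> z = z" "z \<in> carrier R"
  shows "WD i j \<epsilon> p \<otimes> z = \<zero>" "WU i j \<epsilon> p \<otimes> z = \<zero>"
proof -
  have "WD i j \<epsilon> p \<otimes> (e k \<otimes> z) = \<zero>" "WU i j \<epsilon> p \<otimes> (e k \<otimes> z) = \<zero>"
    using W_e_other[OF assms(1)] assms(3) by (simp_all flip: m_assoc)
  then show "WD i j \<epsilon> p \<otimes> z = \<zero>" "WU i j \<epsilon> p \<otimes> z = \<zero>" by (simp_all only: assms(2))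
qed

lemma W_x:
  assumes "2 \<le> j"
  shows "WD i j \<epsilon> p \<otimes> x j = (if \<epsilon> then \<zero> else WD i j True p)"
    and "WU i j \<epsilon> p \<otimes> x j = (if \<epsilon> then \<zero> else WU i j True p)"
proof -
  have "X j \<epsilon> \<otimes> x j = (if \<epsilon> then \<zero> else X j True)" by (simp add: X_def x_x)
  then have *: "X j \<epsilon> \<otimes> (x j \<otimes> c j [^] p) = (if \<epsilon> then \<zero> else X j True \<otimes> c j [^] p)"
    by (simp flip: m_assoc)
  show "WD i j \<epsilon> p \<otimes> x j = (if \<epsilon> then \<zero> else WD i j True p)"
    using assms by (simp add: WD_def m_assoc pow_x *)
  show "WU i j \<epsilon> p \<otimes> x j = (if \<epsilon> then \<zero> else WU i j True p)"
    using assms by (simp add: WU_def m_assoc pow_x *)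
qed

lemma h_pow: "z \<in> carrier R \<Longrightarrow> z \<otimes> c j [^] (p::nat) \<otimes> h j k = z \<otimes> h j k \<otimes> c k [^] p"
  by (simp add: m_assoc pow_h)

lemma P_i_1: "2 \<le> i \<Longrightarrow> P i 1 = P i 2 \<otimes> h 2 1"
  using P_down[of 1 i] by (simp add: Suc_1)

lemma P_1_2: "P 1 2 = e 1 \<otimes> h 1 2"
  using P_up[of 1 1] by (simp add: P_refl Suc_1)

lemma WD_21:
  assumes "2 \<le> i"
  shows "WD i 2 True p \<otimes> h 2 1 = WD i 1 True p" "WD i 2 False p \<otimes> h 2 1 = WU i 1 False p"
proof -
  show "WD i 2 True p \<otimes> h 2 1 = WD i 1 True p"
    by (simp add: WD_def h_pow X_def)
  have "P i 1 \<otimes> (e 1 \<otimes> \<one> \<otimes> c 1 [^] p) = P i 1 \<otimes> c 1 [^] p"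
    by (simp add: P_e flip: m_assoc)
  then show "WD i 2 False p \<otimes> h 2 1 = WU i 1 False p"
    using assms by (simp add: WD_def WU_def h_pow X_def P_refl P_e P_i_1[symmetric])
qed

text \<open>The two terms on the left contain the two summands of \<open>c 2\<close>, placed between
  \<open>P i 2\<close> and a power of \<open>c 2\<close>. The detour is kept on the left to avoid a
  subtraction.\<close>

lemma WD_12:
  assumes "2 \<le> i"
  shows "WD i 1 True p \<otimes> h 1 2 \<oplus> WU i 2 True p = WD i 2 False (Suc p)"
proof -
  have "WD i 1 True p \<otimes> h 1 2 = P i 2 \<otimes> (x 2 \<otimes> h 2 1 \<otimes> h 1 2) \<otimes> c 2 [^] p"
    by (simp add: WD_def h_pow) (simp add: m_assoc)
  moreover have "WU i 2 True p = P i 2 \<otimes> (h 2 1 \<otimes> h 1 2 \<otimes> x 2) \<otimes> c 2 [^] p"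
    using assms by (simp add: WU_def X_def P_i_1 P_1_2 e_h m_assoc)
  moreover have "WD i 2 False (Suc p) = P i 2 \<otimes> c 2 \<otimes> c 2 [^] p"
    by (simp add: WD_def X_def m_assoc pow_c)
  ultimately show ?thesis
    by (simp add: c_2 l_distr r_distr a_comm)
qed


lemma P_away:
  assumes "(i \<le> j \<and> k = Suc j) \<or> (j \<le> i \<and> j = Suc k)"
  shows "P i j \<otimes> h j k = P i k"
  using assms P_up[of i j] P_down[of k i] by auto

text \<open>The step undoes the last arrow of the path and leaves a round trip at the new
  end.\<close>

lemma P_toward:
  assumes "(i < j \<and> j = Suc k) \<or> (j < i \<and> k = Suc j)" "2 \<le> j" "2 \<le> k"
  shows "P i j \<otimes> h j k = P i k \<otimes> c k"
  using assms P_up[of i k] P_down[of j i] c_up[of k] c_down[of j] by (auto simp: m_assoc)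

text \<open>The exponent grows exactly when the step goes back towards \<open>i\<close>; at
  \<open>i\<close> itself both directions lead away.\<close>

lemma WD_h:
  assumes "adjacent j k" "2 \<le> j" "2 \<le> k"
  shows "WD i j \<epsilon> p \<otimes> h j k
    = WD i k \<epsilon> (if (i < j \<and> k < j) \<or> (j < i \<and> j < k) then Suc p else p)"
proof -
  have "WD i j \<epsilon> p \<otimes> h j k = P i j \<otimes> h j k \<otimes> X k \<epsilon> \<otimes> c k [^] p"
    using assms by (simp add: WD_def h_pow) (simp add: m_assoc X_h)
  moreover have "P i k \<otimes> c k \<otimes> X k \<epsilon> \<otimes> c k [^] p = WD i k \<epsilon> (Suc p)"
    using assms X_c[of k \<epsilon> 1]
    by (simp add: WD_def m_assoc pow_c)
      (simp flip: m_assoc)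
  ultimately show ?thesis
    using assms P_away[of i j k] P_toward[of i j k] by (auto simp: adjacent_def WD_def simp flip: Suc_eq_plus1)
qed

text \<open>A detour last turned round at 1, so going back is measured from 1 and not from
  \<open>i\<close>.\<close>

lemma WU_h:
  assumes "adjacent j k" "2 \<le> j" "2 \<le> k"
  shows "WU i j \<epsilon> p \<otimes> h j k = WU i k \<epsilon> (if k < j then Suc p else p)"
proof -
  have "WU i j \<epsilon> p \<otimes> h j k = P i 1 \<otimes> (P 1 j \<otimes> h j k) \<otimes> X k \<epsilon> \<otimes> c k [^] p"
    using assms by (simp add: WU_def h_pow) (simp add: m_assoc X_h)
  moreover have "P i 1 \<otimes> (P 1 k \<otimes> c k) \<otimes> X k \<epsilon> \<otimes> c k [^] p = WU i k \<epsilon> (Suc p)"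
    using assms X_c[of k \<epsilon> 1]
    by (simp add: WU_def m_assoc pow_c)
      (simp flip: m_assoc)
  ultimately show ?thesis
    using assms P_away[of 1 j k] P_toward[of 1 j k] by (auto simp: adjacent_def WU_def simp flip: Suc_eq_plus1)
qed

lemma WU_12: "WU i 1 False p \<otimes> h 1 2 = WU i 2 False p"
  by (simp add: WU_def h_pow X_def P_refl P_1_2) (simp add: m_assoc)

lemma WU_21: "WU i 2 \<epsilon> p \<otimes> h 2 1 = (if \<epsilon> then WU i 1 False (Suc p) else \<zero>)"
proof -
  have "WU i 2 \<epsilon> p \<otimes> h 2 1 = P i 1 \<otimes> (h 1 2 \<otimes> X 2 \<epsilon> \<otimes> h 2 1) \<otimes> c 1 [^] p"
    by (simp add: WU_def h_pow P_1_2 e_h) (simp add: m_assoc)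
  moreover have "WU i 1 False (Suc p) = P i 1 \<otimes> c 1 \<otimes> c 1 [^] p"
    by (simp add: WU_def X_def P_refl P_e m_assoc pow_c)
  ultimately show ?thesis
    using c_1 h_12_21 by (simp add: X_def)
qed

text \<open>If \<open>j\<close> is the larger vertex, the power at the end of the path is zero.
  Otherwise centrality transports it back to \<open>i\<close>, where it is zero.\<close>

lemma WD_overflow:
  assumes "2 \<le> i" "1 \<le> j" "i \<le> n" "j \<le> n" "n < p + max i j"
  shows "WD i j \<epsilon> p = \<zero>"
proof (cases "i \<le> j")
  case True
  then have "c j [^] p = \<zero>" using assms by (intro c_nilpotent) auto
  then show ?thesis by (simp add: WD_def)
next
  case False
  then have ci: "c i [^] p = \<zero>" using assms by (intro c_nilpotent) auto
  have "P i j' \<otimes> c j' [^] p = \<zero>" if "1 \<le> j'" for j'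
    using P_c[of i j' p] assms ci that by simp
  note * = this[of j] this[of 2]
  have "P i j \<otimes> X j \<epsilon> \<otimes> c j [^] p = \<zero>" if "j \<noteq> 1"
    using that assms * by (simp add: m_assoc X_c) (simp flip: m_assoc)
  moreover have "P i 2 \<otimes> x 2 \<otimes> h 2 1 \<otimes> c 1 [^] p = \<zero>"
    using * by (simp add: m_assoc pow_h[symmetric])
      (simp add: pow_x[symmetric] flip: m_assoc)
  ultimately show ?thesis by (simp add: WD_def)
qed

lemma WU_overflow:
  assumes "1 \<le> i" "1 \<le> j" "i \<le> n" "j \<le> n" "j = 1 \<Longrightarrow> \<not> \<epsilon>" "n < p + max i j"
  shows "WU i j \<epsilon> p = \<zero>"
proof (cases "i \<le> j")
  case True
  then have "c j [^] p = \<zero>" using assms by (intro c_nilpotent) auto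
  then show ?thesis by (simp add: WU_def)
next
  case False
  then have ci: "c i [^] p = \<zero>" using assms by (intro c_nilpotent) auto
  have "X j \<epsilon> \<otimes> c j [^] p = c j [^] p \<otimes> X j \<epsilon>"
    using assms X_c[of j] by (cases "j = 1") (auto simp: X_def)
  then have "WU i j \<epsilon> p = P i 1 \<otimes> (P 1 j \<otimes> c j [^] p) \<otimes> X j \<epsilon>"
    by (simp add: WU_def m_assoc)
  also have "\<dots> = c i [^] p \<otimes> P i 1 \<otimes> P 1 j \<otimes> X j \<epsilon>"
    using assms by (simp add: P_c[of 1 j, symmetric] P_c[of i 1] flip: m_assoc)
  finally show ?thesis using ci by simp
qed

end

section \<open>The action on functions of basis indices\<close>

lemma poly_mapping_add_induct [case_names single add]:
  assumes "\<And>k v. P (Poly_Mapping.single k v)" and "\<And>f g. P f \<Longrightarrow> P g \<Longrightarrow> P (f + g)"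
  shows "P (f :: 'a \<Rightarrow>\<^sub>0 'b::comm_monoid_add)"
proof (induction f rule: update_induct)
  case const
  show ?case using assms(1)[of undefined 0] by simp
next
  case (update f a b)
  have "Poly_Mapping.update a b f = f + Poly_Mapping.single a b"
    using update by (intro poly_mapping_eqI)
      (auto simp: lookup_add lookup_update lookup_single in_keys_iff)
  then show ?case using assms update by simp
qed

text \<open>
  \<open>Direct i j \<epsilon> p\<close> and \<open>Detour i j \<epsilon> p\<close> index the monomials that consist of a path
  from \<open>i\<close> to \<open>j\<close>, monotone or through the vertex 1, followed by \<open>x\<^sub>j\<^sup>\<epsilon>\<close> and the \<open>p\<close>-th power of the loop at \<open>j\<close>. There is no
  \<open>x\<^sub>1\<close>: for \<open>j = 1\<close> the path through \<open>x\<^sub>2\<close> is encoded as \<open>Direct i 1 True p\<close> and the path without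
  \<open>x\<^sub>2\<close> as \<open>Detour i 1 False p\<close>.
\<close>

datatype state = Direct nat nat bool nat | Detour nat nat bool nat

fun src :: "state \<Rightarrow> nat" where
  "src (Direct i j \<epsilon> p) = i"
| "src (Detour i j \<epsilon> p) = i"

fun tgt :: "state \<Rightarrow> nat" where
  "tgt (Direct i j \<epsilon> p) = j"
| "tgt (Detour i j \<epsilon> p) = j"

text \<open>Every path starting at 1 counts as a detour, so direct ones start at 2 or above; no
  monomial gets two indices.\<close>

fun shape :: "state \<Rightarrow> bool" where
  "shape (Direct i j \<epsilon> p) \<longleftrightarrow> 2 \<le> i \<and> 1 \<le> j \<and> (j = 1 \<longrightarrow> \<epsilon>)"
| "shape (Detour i j \<epsilon> p) \<longleftrightarrow> 1 \<le> i \<and> 1 \<le> j \<and> (j = 1 \<longrightarrow> \<not> \<epsilon>)"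

text \<open>Bounding this sum by \<open>n\<close> expresses \<open>p \<le> n - max i j\<close>
  without truncated subtraction and bounds both vertices at the same time.\<close>

fun height :: "state \<Rightarrow> nat" where
  "height (Direct i j \<epsilon> p) = p + max i j"
| "height (Detour i j \<epsilon> p) = p + max i j"

definition basis :: "nat \<Rightarrow> state set"
  where "basis n = {s. shape s \<and> height s \<le> n}"

fun loop :: "(state \<Rightarrow> 'm::ab_group_add) \<Rightarrow> state \<Rightarrow> 'm" where
  "loop \<phi> (Direct i j \<epsilon> p) = (if \<epsilon> then 0 else \<phi> (Direct i j True p))"
| "loop \<phi> (Detour i j \<epsilon> p) = (if \<epsilon> then 0 else \<phi> (Detour i j True p))"

text \<open>The clauses transcribe \<open>WD_21\<close>, \<open>WD_12\<close>, \<open>WD_h\<close>,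
  \<open>WU_12\<close>, \<open>WU_21\<close> and \<open>WU_h\<close>, hence describe the
  sign-adjusted arrows \<open>h\<close>; \<open>gen_act\<close> restores the sign of the
  generator.\<close>

fun move :: "(state \<Rightarrow> 'm::ab_group_add) \<Rightarrow> state \<Rightarrow> nat \<Rightarrow> 'm" where
  "move \<phi> (Direct i j \<epsilon> p) k =
    (if k = 1 then if \<epsilon> then \<phi> (Direct i 1 True p) else \<phi> (Detour i 1 False p)
     else if j = 1 then \<phi> (Direct i 2 False (Suc p)) - \<phi> (Detour i 2 True p)
     else \<phi> (Direct i k \<epsilon> (if (i < j \<and> k < j) \<or> (j < i \<and> j < k) then Suc p else p)))"
| "move \<phi> (Detour i j \<epsilon> p) k =
    (if k = 1 then if \<epsilon> then \<phi> (Detour i 1 False (Suc p)) else 0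
     else \<phi> (Detour i k \<epsilon> (if k < j then Suc p else p)))"

text \<open>
  \<open>gen_act a \<phi> s\<close> is the value of the linear extension of \<open>\<phi>\<close> at the product of the monomial \<open>s\<close>
  and the generator \<open>a\<close>. It is used both for \<open>\<phi>\<close> with values in the field, where it gives a
  representation, and for the \<open>\<phi>\<close> that sends an index to its monomial, where it gives the
  reduction of words.
\<close>

fun gen_act :: "gen \<Rightarrow> (state \<Rightarrow> 'm::ab_group_add) \<Rightarrow> state \<Rightarrow> 'm" where
  "gen_act (Vert k) \<phi> s = (if shape s \<and> tgt s = k then \<phi> s else 0)"
| "gen_act (Loop k) \<phi> s = (if shape s \<and> tgt s = k \<and> 2 \<le> k then loop \<phi> s else 0)"
| "gen_act (Arr j k) \<phi> s =
    (if shape s \<and> tgt s = j \<and> adjacent j k \<and> 1 \<le> k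
     then if odd j \<and> k < j then - move \<phi> s k else move \<phi> s k else 0)"

text \<open>With field values this is the dual of the span of the basis; vanishing outside encodes
  that monomials of excessive height are zero.\<close>

definition supp_fun :: "nat \<Rightarrow> (state \<Rightarrow> 'm::zero) set"
  where "supp_fun n = {\<phi>. \<forall>s. s \<notin> basis n \<longrightarrow> \<phi> s = 0}"

lemma loop_natural:
  assumes "additive \<theta>"
  shows "loop (\<lambda>s. \<theta> (\<phi> s)) s = \<theta> (loop \<phi> s)"
  using additive.zero[OF assms] by (cases s) auto

lemma move_natural:
  assumes "additive \<theta>"
  shows "move (\<lambda>s. \<theta> (\<phi> s)) s k = \<theta> (move \<phi> s k)"
  using additive.zero[OF assms] additive.diff[OF assms] by (cases s) auto

text \<open>The formulas only add and negate values. Used with \<open>\<theta>\<close> a right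
  multiplication, a scaling, or the map sending a scalar to a multiple of a fixed monomial.\<close>

lemma gen_act_natural:
  assumes "additive \<theta>"
  shows "gen_act a (\<lambda>s. \<theta> (\<phi> s)) s = \<theta> (gen_act a \<phi> s)"
  using additive.zero[OF assms] additive.minus[OF assms] loop_natural[OF assms] move_natural[OF assms]
  by (cases a) auto

lemma gen_act_add: "gen_act a (\<lambda>s. \<phi> s + \<psi> s) = (\<lambda>s. gen_act a \<phi> s + gen_act a \<psi> s)"
proof
  fix s
  have "loop (\<lambda>s. \<phi> s + \<psi> s) s = loop \<phi> s + loop \<psi> s" by (cases s) auto
  moreover have "move (\<lambda>s. \<phi> s + \<psi> s) s k = move \<phi> s k + move \<psi> s k" for k by (cases s) auto
  ultimately show "gen_act a (\<lambda>s. \<phi> s + \<psi> s) s = gen_act a \<phi> s + gen_act a \<psi> s"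
    by (cases a) auto
qed

lemma gen_act_zero: "gen_act a (\<lambda>s. 0) = (\<lambda>s. 0)"
  using gen_act_natural[of "\<lambda>x. 0" a "\<lambda>_. 0"] by (auto simp: additive_def)

text \<open>No generator lowers the height: a step can lower \<open>max i j\<close> only by one, and
  then it raises \<open>p\<close> by one.\<close>

lemma gen_act_supp_fun:
  assumes "\<phi> \<in> supp_fun n"
  shows "gen_act a \<phi> \<in> supp_fun n"
proof -
  have z: "\<phi> s = 0" if "n < height s" for s
    using that assms by (auto simp: supp_fun_def basis_def)
  have "loop \<phi> s = 0" if "n < height s" for s
    using that by (cases s) (auto simp: z)
  moreover have "move \<phi> s k = 0" if "n < height s" "shape s" "adjacent (tgt s) k" for s k
    using that by (cases s) (auto simp: z adjacent_def)
  ultimately show ?thesis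
    unfolding supp_fun_def basis_def by (cases a) (auto simp: z not_le)
qed

text \<open>The value at \<open>s\<close> is \<open>\<phi>\<close> evaluated after following the
  word from \<open>s\<close>. Right multiplication on indices thus becomes a left action on
  functions, with no reversal of words.\<close>

definition word_act :: "gen free_monoid \<Rightarrow> (state \<Rightarrow> 'm::ab_group_add) \<Rightarrow> state \<Rightarrow> 'm"
  where "word_act w = foldr gen_act (letters w)"

lemma word_act_0 [simp]: "word_act 0 \<phi> = \<phi>"
  by (simp add: word_act_def zero_free_monoid_def)

lemma word_act_add: "word_act (v + w) \<phi> = word_act v (word_act w \<phi>)"
  by (simp add: word_act_def plus_free_monoid_def)

lemma word_act_single [simp]: "word_act (Word [a]) \<phi> = gen_act a \<phi>"
  by (simp add: word_act_def)

lemma word_induct [case_names zero gen]: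
  assumes "P 0" and "\<And>a w. P w \<Longrightarrow> P (Word [a] + w)"
  shows "P w"
proof (cases w)
  case (Word as)
  have "P (Word as)"
  proof (induction as)
    case (Cons a as)
    then show ?case using assms(2)[of "Word as" a] by (simp add: plus_free_monoid_def)
  qed (use assms(1) in \<open>simp add: zero_free_monoid_def\<close>)
  then show ?thesis using Word by simp
qed

lemma word_act_natural:
  "additive \<theta> \<Longrightarrow> word_act w (\<lambda>s. \<theta> (\<phi> s)) s = \<theta> (word_act w \<phi> s)"
proof (induction w arbitrary: s rule: word_induct)
  case (gen a w)
  then have "word_act w (\<lambda>s. \<theta> (\<phi> s)) = (\<lambda>s. \<theta> (word_act w \<phi> s))" by auto
  then show ?case using gen by (simp add: word_act_add gen_act_natural)
qed simp

lemma word_act_plus: "word_act w (\<lambda>s. \<phi> s + \<psi> s) = (\<lambda>s. word_act w \<phi> s + word_act w \<psi> s)"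
  by (induction w rule: word_induct) (simp_all add: word_act_add gen_act_add)

lemma word_act_zero: "word_act w (\<lambda>s. 0) = (\<lambda>s. 0)"
  by (induction w rule: word_induct) (simp_all add: word_act_add gen_act_zero)

lemma word_act_sum: "word_act w (\<lambda>s. \<Sum>b\<in>B. \<phi> b s) = (\<lambda>s. \<Sum>b\<in>B. word_act w (\<phi> b) s)"
  by (induction B rule: infinite_finite_induct) (simp_all add: word_act_plus word_act_zero)

lemma word_act_supp_fun: "\<phi> \<in> supp_fun n \<Longrightarrow> word_act w \<phi> \<in> supp_fun n"
  by (induction w rule: word_induct) (simp_all add: word_act_add gen_act_supp_fun)

section \<open>The representation of the free algebra on functions\<close>

definition act :: "(gen, 'k::field) free_alg \<Rightarrow> (state \<Rightarrow> 'k) \<Rightarrow> state \<Rightarrow> 'k"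
  where "act f \<phi> s = (\<Sum>w\<in>Poly_Mapping.keys f. Poly_Mapping.lookup f w * word_act w \<phi> s)"

lemma act_superset:
  "finite A \<Longrightarrow> Poly_Mapping.keys f \<subseteq> A \<Longrightarrow>
    act f \<phi> s = (\<Sum>w\<in>A. Poly_Mapping.lookup f w * word_act w \<phi> s)"
  unfolding act_def by (rule sum.mono_neutral_left) (auto simp: in_keys_iff)

lemma act_zero [simp]: "act 0 \<phi> = (\<lambda>s. 0)"
  by (simp add: act_def fun_eq_iff)

lemma act_add: "act (f + g) \<phi> = (\<lambda>s. act f \<phi> s + act g \<phi> s)"
proof
  fix s
  define A where "A = Poly_Mapping.keys f \<union> Poly_Mapping.keys g"
  have "finite A" "Poly_Mapping.keys f \<subseteq> A" "Poly_Mapping.keys g \<subseteq> A" "Poly_Mapping.keys (f + g) \<subseteq> A"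
    using Poly_Mapping.keys_add[of f g] by (auto simp: A_def)
  then show "act (f + g) \<phi> s = act f \<phi> s + act g \<phi> s"
    by (simp add: act_superset[of A] lookup_add distrib_right sum.distrib)
qed

lemma act_uminus: "act (- f) \<phi> = (\<lambda>s. - act f \<phi> s)"
  using act_add[of f "- f" \<phi>] by (auto simp: fun_eq_iff eq_neg_iff_add_eq_0 add.commute)

lemma act_diff: "act (f - g) \<phi> = (\<lambda>s. act f \<phi> s - act g \<phi> s)"
  using act_add[of f "- g" \<phi>] by (simp add: act_uminus)

lemma act_sum: "act (\<Sum>i\<in>I. f i) \<phi> s = (\<Sum>i\<in>I. act (f i) \<phi> s)"
  by (induction I rule: infinite_finite_induct) (simp_all add: act_add)

lemma act_single: "act (Poly_Mapping.single w c) \<phi> = (\<lambda>s. c * word_act w \<phi> s)"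
  by (cases "c = 0") (simp_all add: act_def fun_eq_iff)

lemma act_gen [simp]: "act (gen_elt a) \<phi> = gen_act a \<phi>"
  by (simp add: gen_elt_def act_single fun_eq_iff)

lemma act_one [simp]: "act 1 \<phi> = \<phi>"
  by (simp add: act_single fun_eq_iff flip: single_one)

lemma act_mult: "act (f * g) \<phi> = act f (act g \<phi>)"
proof (induction f rule: poly_mapping_add_induct)
  case (single u c)
  show ?case
  proof (induction g rule: poly_mapping_add_induct)
    case (single v d)
    have "additive (\<lambda>x. d * x)" by (simp add: additive_def distrib_left)
    then show ?case
      by (simp add: mult_single act_single word_act_add word_act_natural fun_eq_iff)
  next
    case (add f g)
    then show ?case by (simp add: distrib_left act_add act_single word_act_plus)
  qed
next
  case (add f g)
  then show ?case by (simp add: distrib_right act_add)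
qed

lemma act_fun_zero: "act f (\<lambda>s. 0) = (\<lambda>s. 0)"
  by (simp add: act_def word_act_zero fun_eq_iff)

lemma act_supp_fun: "\<phi> \<in> supp_fun n \<Longrightarrow> act f \<phi> \<in> supp_fun n"
  using word_act_supp_fun[of \<phi> n] by (force simp: act_def supp_fun_def intro!: sum.neutral)

text \<open>Only functions in \<open>supp_fun n\<close> are tested, because some relations, such as
  the one at the vertex \<open>n\<close>, hold only after truncation by height.\<close>

definition annihilator :: "nat \<Rightarrow> (gen, 'k::field) free_alg set"
  where "annihilator n =
    {f \<in> carrier (free_algebra (gens n)). \<forall>\<phi>\<in>supp_fun n. act f \<phi> = (\<lambda>s. 0)}"

lemma annihilator_ideal: "ideal (annihilator n) (free_algebra (gens n) :: (gen, 'k::field) free_alg ring)"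
proof -
  interpret R: ring "free_algebra (gens n) :: (gen, 'k::field) free_alg ring"
    by (rule free_algebra_ring)
  let ?R = "free_algebra (gens n) :: (gen, 'k) free_alg ring"
  have inv: "\<ominus>\<^bsub>?R\<^esub> f = - f" if "f \<in> carrier ?R" for f
    using that by (intro R.minus_equality) (auto simp: mem_carrier_free_algebra)
  have add: "f + g \<in> carrier ?R" if "f \<in> carrier ?R" "g \<in> carrier ?R" for f g
    using R.a_closed[OF that] by simp
  have mult: "f * g \<in> carrier ?R" if "f \<in> carrier ?R" "g \<in> carrier ?R" for f g
    using R.m_closed[OF that] by simp
  have zero: "0 \<in> carrier ?R" using R.zero_closed by simp
  have uminus: "- f \<in> carrier ?R" if "f \<in> carrier ?R" for f
    using that by (simp add: mem_carrier_free_algebra)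
  show ?thesis
  proof (rule idealI)
    show "subgroup (annihilator n) (add_monoid ?R)"
    proof (rule R.add.subgroupI)
      show "annihilator n \<subseteq> carrier ?R" "(annihilator n :: (gen, 'k) free_alg set) \<noteq> {}"
        using zero by (auto simp: annihilator_def intro!: exI[of _ 0])
      show "\<ominus>\<^bsub>?R\<^esub> f \<in> annihilator n" if "f \<in> annihilator n" for f
        using that uminus inv[of f] unfolding annihilator_def by (simp add: act_uminus)
      show "f \<oplus>\<^bsub>?R\<^esub> g \<in> annihilator n" if "f \<in> annihilator n" "g \<in> annihilator n" for f g
        using that add by (auto simp: annihilator_def act_add)
    qed
  \<comment> \<open>For a right factor \<open>g\<close>, \<open>act (f * g) \<phi>\<close> is
    \<open>act f\<close> applied to \<open>act g \<phi>\<close>, which again lies in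
    \<open>supp_fun n\<close>.\<close>
  qed (use mult in \<open>auto simp: annihilator_def act_mult act_fun_zero act_supp_fun R.ring_axioms\<close>)
qed

lemma basisD:
  assumes "s \<in> basis n"
  shows "src s \<in> {1..n}" "tgt s \<in> {1..n}" "shape s" "height s \<le> n"
  using assms by (cases s; auto simp: basis_def)+

lemma rels_annihilator:
  assumes "2 \<le> n"
  shows "path_rels n \<union> preproj_rels n \<subseteq> (annihilator n :: (gen, 'k::field) free_alg set)"
proof
  fix r :: "(gen, 'k) free_alg"
  assume r: "r \<in> path_rels n \<union> preproj_rels n"
  have "act r \<phi> s = 0" if \<phi>: "\<phi> \<in> supp_fun n" for \<phi> s
  proof -
    \<comment> \<open>Truncation disposes of products leaving the basis, in particular of the round
      trip from \<open>n\<close> through \<open>n - 1\<close>.\<close>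
    have z: "\<phi> s = 0" if "shape s \<longrightarrow> n < height s" for s
      using \<phi> that by (auto simp: supp_fun_def basis_def not_le)
    note act_simps = act_diff act_add act_mult
    from r consider (path) "r \<in> path_rels n" | (preproj) "r \<in> preproj_rels n" by blast
    then show ?thesis
    proof cases
      case path
      have "(\<Sum>i = 1..n. if shape s \<and> tgt s = i then \<phi> s else 0) = \<phi> s"
      proof (cases "s \<in> basis n")
        case True
        then show ?thesis
          using basisD(2,3)[OF True] by (simp add: sum.delta')
      next
        case False
        then show ?thesis using \<phi> by (auto simp: supp_fun_def intro!: sum.neutral)
      qed
      then show ?thesis
        using path unfolding path_rels_def
        by (cases s) (auto simp: act_simps act_sum adjacent_def)
    next
      case preproj
      show ?thesis
        \<comment> \<open>At \<open>Direct i 2 False p\<close> the negative detour in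
          \<open>move\<close> cancels the product taken in the other order. The remaining term
          cancels against the trip through 3, or vanishes by height if \<open>n = 2\<close>.\<close>
        using preproj assms unfolding preproj_rels_def
        apply (cases s)
        apply (auto simp: act_simps adjacent_def z split: if_splits)
        done
    qed
  qed
  moreover have "r \<in> carrier (free_algebra (gens n))" using rels_carrier[OF assms] r by blast
  ultimately show "r \<in> annihilator n" by (auto simp: annihilator_def)
qed

section \<open>Standard monomials and the quotient map\<close>

definition vert_elt :: "nat \<Rightarrow> nat \<Rightarrow> (gen, 'k::field) free_alg"
  where "vert_elt n i = (if i \<in> {1..n} then e_elt i else 0)"

definition nil_elt :: "nat \<Rightarrow> nat \<Rightarrow> (gen, 'k::field) free_alg"
  where "nil_elt n i = (if i \<in> {2..n} then x_elt i else 0)"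

text \<open>Of two consecutive vertices one is odd, so at each vertex from 3 on exactly one round
  trip changes sign and the relation becomes an equality of loops. The arrow from 2 to 1 keeps its
  sign and that from 3 to 2 changes it, as the relation at 2 requires.\<close>

definition arrow_elt :: "nat \<Rightarrow> nat \<Rightarrow> nat \<Rightarrow> (gen, 'k::field) free_alg"
  where "arrow_elt n i j =
    (if i \<in> {1..n} \<and> j \<in> {1..n} \<and> adjacent i j
     then if odd i \<and> j < i then - g_elt i j else g_elt i j else 0)"

definition path_elt :: "nat \<Rightarrow> nat \<Rightarrow> nat \<Rightarrow> (gen, 'k::field) free_alg"
  where "path_elt n i j =
    (if i \<le> j then vert_elt n i * prod_list (map (\<lambda>k. arrow_elt n k (Suc k)) [i..<j])
     else vert_elt n i * prod_list (map (\<lambda>k. arrow_elt n (Suc k) k) (rev [j..<i])))"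

definition loop_elt :: "nat \<Rightarrow> nat \<Rightarrow> (gen, 'k::field) free_alg"
  where "loop_elt n j =
    (if j = 1 then arrow_elt n 1 2 * nil_elt n 2 * arrow_elt n 2 1 else arrow_elt n j (Suc j) * arrow_elt n (Suc j) j)"

definition nil_pow :: "nat \<Rightarrow> nat \<Rightarrow> bool \<Rightarrow> (gen, 'k::field) free_alg"
  where "nil_pow n j \<epsilon> = (if \<epsilon> then nil_elt n j else 1)"

fun elt :: "nat \<Rightarrow> state \<Rightarrow> (gen, 'k::field) free_alg" where
  "elt n (Direct i j \<epsilon> p) =
    (if j = 1 then path_elt n i 2 * nil_elt n 2 * arrow_elt n 2 1 else path_elt n i j * nil_pow n j \<epsilon>) * loop_elt n j ^ p"
| "elt n (Detour i j \<epsilon> p) = path_elt n i 1 * path_elt n 1 j * nil_pow n j \<epsilon> * loop_elt n j ^ p"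

lemma path_refl: "path_elt n i i = vert_elt n i"
  by (simp add: path_elt_def)

lemma path_up: "i \<le> j \<Longrightarrow> path_elt n i (Suc j) = path_elt n i j * arrow_elt n j (Suc j)"
  by (simp add: path_elt_def mult.assoc)

lemma path_down: "j < i \<Longrightarrow> path_elt n i j = path_elt n i (Suc j) * arrow_elt n (Suc j) j"
  by (simp add: path_elt_def mult.assoc upt_conv_Cons not_le)

abbreviation free_carrier :: "nat \<Rightarrow> (gen, 'k::field) free_alg set"
  where "free_carrier n \<equiv> carrier (free_algebra (gens n))"

lemma free_carrier_closed [simp]:
  fixes f g :: "(gen, 'k::field) free_alg"
  shows
  "f \<in> free_carrier n \<Longrightarrow> g \<in> free_carrier n \<Longrightarrow> f + g \<in> free_carrier n"
  "f \<in> free_carrier n \<Longrightarrow> g \<in> free_carrier n \<Longrightarrow> f * g \<in> free_carrier n"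
  "f \<in> free_carrier n \<Longrightarrow> - f \<in> free_carrier n"
  "(0 :: (gen, 'k) free_alg) \<in> free_carrier n" "(1 :: (gen, 'k) free_alg) \<in> free_carrier n"
proof -
  interpret R: ring "free_algebra (gens n) :: (gen, 'k) free_alg ring" by (rule free_algebra_ring)
  show "f + g \<in> free_carrier n" "f * g \<in> free_carrier n"
    if "f \<in> free_carrier n" "g \<in> free_carrier n" for f g :: "(gen, 'k) free_alg"
    using R.a_closed[OF that] R.m_closed[OF that] by simp_all
  show "(0 :: (gen, 'k) free_alg) \<in> free_carrier n" "(1 :: (gen, 'k) free_alg) \<in> free_carrier n"
    using R.zero_closed R.one_closed by simp_all
qed (simp add: mem_carrier_free_algebra)

lemma free_carrier_diff [simp]:
  "f \<in> free_carrier n \<Longrightarrow> g \<in> free_carrier n \<Longrightarrow> f - g \<in> free_carrier n"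
  using free_carrier_closed(1)[of f n "- g"] by simp

lemma free_carrier_power [simp]: "f \<in> free_carrier n \<Longrightarrow> f ^ p \<in> free_carrier n"
  by (induction p) simp_all

lemma free_carrier_prod_list: "set fs \<subseteq> free_carrier n \<Longrightarrow> prod_list fs \<in> free_carrier n"
  by (induction fs) simp_all

lemma free_carrier_sum: "(\<And>i. i \<in> I \<Longrightarrow> f i \<in> free_carrier n) \<Longrightarrow> (\<Sum>i\<in>I. f i) \<in> free_carrier n"
  by (induction I rule: infinite_finite_induct) simp_all

lemma free_carrier_gen [simp]: "gen_elt a \<in> (free_carrier n :: (gen, 'k::field) free_alg set) \<longleftrightarrow> a \<in> gens n"
  by (simp add: mem_carrier_free_algebra gen_elt_def)

lemma free_carrier_const [simp]: "Poly_Mapping.single 0 c \<in> free_carrier n"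
  by (auto simp: mem_carrier_free_algebra zero_free_monoid_def)

lemma gens_simps [simp]:
  "Vert i \<in> gens n \<longleftrightarrow> i \<in> {1..n}"
  "Loop i \<in> gens n \<longleftrightarrow> i \<in> {2..n}"
  "Arr i j \<in> gens n \<longleftrightarrow> i \<in> {1..n} \<and> j \<in> {1..n} \<and> adjacent i j"
  by (auto simp: gens_def)

lemma gens_closed [simp]: "vert_elt n i \<in> free_carrier n" "nil_elt n i \<in> free_carrier n" "arrow_elt n i j \<in> free_carrier n"
  by (simp_all add: vert_elt_def nil_elt_def arrow_elt_def)

lemma path_closed [simp]: "path_elt n i j \<in> free_carrier n"
  by (auto simp: path_elt_def intro!: free_carrier_closed(2) free_carrier_prod_list)

lemma loop_closed [simp]: "loop_elt n j \<in> free_carrier n" "nil_pow n j \<epsilon> \<in> free_carrier n"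
  by (auto simp: loop_elt_def nil_pow_def)

lemma elt_closed [simp]: "elt n s \<in> free_carrier n"
  by (cases s) auto

section \<open>The quotient map and the relations it satisfies\<close>

lemma Pi_class_hom:
  assumes "2 \<le> n"
  shows "ring_hom_ring (free_algebra (gens n)) (Pi_B n) (Pi_class n :: _ \<Rightarrow> 'k::field Pi_elt)"
  using ideal.rcos_ring_hom_ring[OF rel_ideal_ideal[OF assms]] unfolding Pi_B_def Pi_class_def[abs_def] .

lemma
  assumes "2 \<le> n"
  shows Pi_class_add: "f \<in> free_carrier n \<Longrightarrow> g \<in> free_carrier n \<Longrightarrow>
      Pi_class n (f + g) = Pi_class n f \<oplus>\<^bsub>Pi_B n\<^esub> (Pi_class n g :: 'k::field Pi_elt)"
    and Pi_class_mult: "f \<in> free_carrier n \<Longrightarrow> g \<in> free_carrier n \<Longrightarrow>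
      Pi_class n (f * g) = Pi_class n f \<otimes>\<^bsub>Pi_B n\<^esub> (Pi_class n g :: 'k::field Pi_elt)"
    and Pi_class_closed: "f \<in> free_carrier n \<Longrightarrow> Pi_class n f \<in> (carrier (Pi_B n) :: 'k Pi_elt set)"
    and Pi_class_zero: "Pi_class n 0 = (\<zero>\<^bsub>Pi_B n\<^esub> :: 'k Pi_elt)"
    and Pi_class_one: "Pi_class n 1 = (\<one>\<^bsub>Pi_B n\<^esub> :: 'k Pi_elt)"
proof -
  interpret H: ring_hom_ring "free_algebra (gens n)" "Pi_B n" "Pi_class n :: _ \<Rightarrow> 'k Pi_elt"
    by (rule Pi_class_hom[OF assms])
  show "f \<in> free_carrier n \<Longrightarrow> g \<in> free_carrier n \<Longrightarrow>
      Pi_class n (f + g) = Pi_class n f \<oplus>\<^bsub>Pi_B n\<^esub> (Pi_class n g :: 'k Pi_elt)"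
    using H.hom_add[of f g] by simp
  show "f \<in> free_carrier n \<Longrightarrow> g \<in> free_carrier n \<Longrightarrow>
      Pi_class n (f * g) = Pi_class n f \<otimes>\<^bsub>Pi_B n\<^esub> (Pi_class n g :: 'k Pi_elt)"
    using H.hom_mult[of f g] by simp
  show "f \<in> free_carrier n \<Longrightarrow> Pi_class n f \<in> (carrier (Pi_B n) :: 'k Pi_elt set)"
    by (rule H.hom_closed)
  show "Pi_class n 0 = (\<zero>\<^bsub>Pi_B n\<^esub> :: 'k Pi_elt)" using H.hom_zero by simp
  show "Pi_class n 1 = (\<one>\<^bsub>Pi_B n\<^esub> :: 'k Pi_elt)" using H.hom_one by simp
qed

lemma Pi_class_eqI:
  assumes "2 \<le> n" "f \<in> free_carrier n" "g \<in> free_carrier n" "f - g \<in> rel_ideal n"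
  shows "Pi_class n f = (Pi_class n g :: 'k::field Pi_elt)"
proof -
  interpret I: ideal "rel_ideal n :: (gen, 'k) free_alg set" "free_algebra (gens n)"
    by (rule rel_ideal_ideal[OF assms(1)])
  have "f \<in> rel_ideal n +>\<^bsub>free_algebra (gens n)\<^esub> g"
    using assms(4) unfolding a_r_coset_def' by (auto intro!: bexI[of _ "f - g"])
  then show ?thesis
    unfolding Pi_class_def by (metis I.a_repr_independence I.is_additive_subgroup assms(3) additive_subgroup.a_subgroup)
qed

lemma Pi_class_power:
  assumes "2 \<le> n" "f \<in> free_carrier n"
  shows "Pi_class n (f ^ p) = Pi_class n f [^]\<^bsub>Pi_B n\<^esub> p"
proof -
  interpret R: ring "Pi_B n" by (rule Pi_B_ring[OF assms(1)])
  show ?thesis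
    by (induction p) (simp_all add: assms Pi_class_one Pi_class_mult Pi_class_closed power_Suc2 del: power_Suc)
qed

lemma rel_in_rel_ideal:
  assumes "2 \<le> n" "r \<in> path_rels n \<union> preproj_rels n"
  shows "r \<in> rel_ideal n"
  unfolding rel_ideal_def
  using ring.genideal_self[OF free_algebra_ring rels_carrier[OF assms(1)]] assms(2) by blast

lemma rel_ideal_le_annihilator: "2 \<le> n \<Longrightarrow> rel_ideal n \<subseteq> annihilator n"
  unfolding rel_ideal_def
  by (rule ring.genideal_minimal[OF free_algebra_ring annihilator_ideal rels_annihilator])

lemma rel_ideal_uminus:
  assumes "2 \<le> n" "- r \<in> rel_ideal n"
  shows "(r :: (gen, 'k::field) free_alg) \<in> rel_ideal n"
proof -
  interpret I: ideal "rel_ideal n :: (gen, 'k) free_alg set" "free_algebra (gens n)"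
    by (rule rel_ideal_ideal[OF assms(1)])
  have "- 1 * - r \<in> rel_ideal n"
    using I.I_l_closed[OF assms(2), of "- 1"] by simp
  then show ?thesis by simp
qed

lemma zero_in_rel_ideal: "2 \<le> n \<Longrightarrow> 0 \<in> rel_ideal n"
  using additive_subgroup.zero_closed[OF ideal.axioms(1)[OF rel_ideal_ideal]] by fastforce

lemma B_relations_Pi:
  assumes n: "2 \<le> n"
  shows "B_relations (Pi_B n :: 'k::field Pi_elt ring) n (\<lambda>i. Pi_class n (vert_elt n i))
    (\<lambda>i. Pi_class n (nil_elt n i)) (\<lambda>i j. Pi_class n (arrow_elt n i j)) (\<lambda>i j. Pi_class n (path_elt n i j))"
proof -
  interpret R: ring "Pi_B n :: 'k Pi_elt ring" by (rule Pi_B_ring[OF n])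
  let ?c = "Pi_class n :: _ \<Rightarrow> 'k Pi_elt"
  note hom = Pi_class_mult[OF n, symmetric] Pi_class_add[OF n, symmetric] Pi_class_zero[OF n, symmetric]
  note I0 = zero_in_rel_ideal[OF n] and Im = rel_ideal_uminus[OF n]
  have Ip: "r \<in> rel_ideal n" if "r \<in> path_rels n" for r :: "(gen, 'k) free_alg"
    using rel_in_rel_ideal[OF n] that by blast
  have Iq: "r \<in> rel_ideal n" if "r \<in> preproj_rels n" for r :: "(gen, 'k) free_alg"
    using rel_in_rel_ideal[OF n] that by blast
  have eq: "?c f = ?c g" if "f - g \<in> rel_ideal n" "f \<in> free_carrier n" "g \<in> free_carrier n" for f g
    using Pi_class_eqI[OF n] that by blast
  have e_e: "?c (vert_elt n i) \<otimes>\<^bsub>Pi_B n\<^esub> ?c (vert_elt n j) = (if i = j then ?c (vert_elt n i) else \<zero>\<^bsub>Pi_B n\<^esub>)" for i j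
  proof -
    have "?c (vert_elt n i * vert_elt n j) = ?c (if i = j then vert_elt n i else 0)"
    proof (rule eq)
      show "vert_elt n i * vert_elt n j - (if i = j then vert_elt n i else 0) \<in> (rel_ideal n :: (gen, 'k) free_alg set)"
      proof (cases "i \<in> {1..n} \<and> j \<in> {1..n}")
        case True
        then show ?thesis by (intro Ip) (auto simp: vert_elt_def path_rels_def)
      qed (auto simp: vert_elt_def I0)
    qed simp_all
    then show ?thesis by (simp add: hom split: if_splits)
  qed
  have e_h: "?c (vert_elt n i * arrow_elt n i j) = ?c (arrow_elt n i j)" for i j
  proof (rule eq)
    show "vert_elt n i * arrow_elt n i j - arrow_elt n i j \<in> (rel_ideal n :: (gen, 'k) free_alg set)"
    proof (cases "i \<in> {1..n} \<and> j \<in> {1..n} \<and> adjacent i j")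
      case True
      then have "e_elt i * g_elt i j - g_elt i j \<in> (rel_ideal n :: (gen, 'k) free_alg set)"
        by (intro Ip) (auto simp: path_rels_def)
      then show ?thesis using True Im[of "g_elt i j - e_elt i * g_elt i j"] by (auto simp: vert_elt_def arrow_elt_def)
    qed (auto simp: arrow_elt_def I0)
  qed simp_all
  have h_e: "?c (arrow_elt n i j * vert_elt n j) = ?c (arrow_elt n i j)" for i j
  proof (rule eq)
    show "arrow_elt n i j * vert_elt n j - arrow_elt n i j \<in> (rel_ideal n :: (gen, 'k) free_alg set)"
    proof (cases "i \<in> {1..n} \<and> j \<in> {1..n} \<and> adjacent i j")
      case True
      then have "g_elt i j * e_elt j - g_elt i j \<in> (rel_ideal n :: (gen, 'k) free_alg set)"
        by (intro Ip) (auto simp: path_rels_def)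
      then show ?thesis using True Im[of "g_elt i j - g_elt i j * e_elt j"] by (auto simp: vert_elt_def arrow_elt_def)
    qed (auto simp: arrow_elt_def I0)
  qed simp_all
  have e_x: "?c (vert_elt n i * nil_elt n i) = ?c (nil_elt n i)" for i
  proof (rule eq)
    show "vert_elt n i * nil_elt n i - nil_elt n i \<in> (rel_ideal n :: (gen, 'k) free_alg set)"
    proof (cases "i \<in> {2..n}")
      case True
      then show ?thesis by (intro Ip) (auto simp: path_rels_def vert_elt_def nil_elt_def)
    qed (auto simp: nil_elt_def I0)
  qed simp_all
  have x_e: "?c (nil_elt n i * vert_elt n i) = ?c (nil_elt n i)" for i
  proof (rule eq)
    show "nil_elt n i * vert_elt n i - nil_elt n i \<in> (rel_ideal n :: (gen, 'k) free_alg set)"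
    proof (cases "i \<in> {2..n}")
      case True
      then show ?thesis by (intro Ip) (auto simp: path_rels_def vert_elt_def nil_elt_def)
    qed (auto simp: nil_elt_def I0)
  qed simp_all
  have x_x: "?c (nil_elt n i * nil_elt n i) = ?c 0" for i
  proof (rule eq)
    show "nil_elt n i * nil_elt n i - 0 \<in> (rel_ideal n :: (gen, 'k) free_alg set)"
    proof (cases "i \<in> {2..n}")
      case True
      then show ?thesis by (intro Iq) (auto simp: preproj_rels_def nil_elt_def)
    qed (auto simp: nil_elt_def I0)
  qed simp_all
  have x_h: "?c (nil_elt n i * arrow_elt n i j) = ?c (arrow_elt n i j * nil_elt n j)" if "2 \<le> i" "2 \<le> j" for i j
  proof (rule eq)
    show "nil_elt n i * arrow_elt n i j - arrow_elt n i j * nil_elt n j \<in> (rel_ideal n :: (gen, 'k) free_alg set)"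
    proof (cases "i \<in> {1..n} \<and> j \<in> {1..n} \<and> adjacent i j")
      case True
      then have "x_elt i * g_elt i j - g_elt i j * x_elt j \<in> (rel_ideal n :: (gen, 'k) free_alg set)"
        using that by (intro Iq) (auto simp: preproj_rels_def)
      then show ?thesis using True that Im[of "g_elt i j * x_elt j - x_elt i * g_elt i j"]
        by (auto simp: nil_elt_def arrow_elt_def)
    qed (auto simp: arrow_elt_def I0)
  qed simp_all
  have h_12: "arrow_elt n 1 2 = g_elt 1 2" and h_21: "arrow_elt n 2 1 = g_elt 2 1" and x_2: "nil_elt n 2 = x_elt 2"
    using n by (simp_all add: arrow_elt_def nil_elt_def adjacent_def)
  have h_12_21: "?c (arrow_elt n 1 2 * arrow_elt n 2 1) = ?c 0"
  proof (rule eq)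
    show "arrow_elt n 1 2 * arrow_elt n 2 1 - 0 \<in> (rel_ideal n :: (gen, 'k) free_alg set)"
      unfolding h_12 h_21 by (rule Iq) (simp add: preproj_rels_def)
  qed simp_all
  have rel_2: "?c (arrow_elt n 2 1 * arrow_elt n 1 2 * nil_elt n 2 + nil_elt n 2 * arrow_elt n 2 1 * arrow_elt n 1 2) = ?c (arrow_elt n 2 3 * arrow_elt n 3 2)"
  proof (rule eq)
    have "arrow_elt n 2 3 * arrow_elt n 3 2 = - (if n \<ge> 3 then g_elt 2 3 * g_elt 3 2 else 0 :: (gen, 'k) free_alg)"
      by (simp add: arrow_elt_def adjacent_def)
    then show "arrow_elt n 2 1 * arrow_elt n 1 2 * nil_elt n 2 + nil_elt n 2 * arrow_elt n 2 1 * arrow_elt n 1 2 - arrow_elt n 2 3 * arrow_elt n 3 2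
        \<in> (rel_ideal n :: (gen, 'k) free_alg set)"
      unfolding h_12 h_21 x_2 by (intro Iq) (simp add: preproj_rels_def)
  qed simp_all
  have rel_j: "?c (arrow_elt n j (Suc j) * arrow_elt n (Suc j) j) = ?c (arrow_elt n j (j - 1) * arrow_elt n (j - 1) j)"
    if "3 \<le> j" for j
  proof (rule eq)
    show "arrow_elt n j (Suc j) * arrow_elt n (Suc j) j - arrow_elt n j (j - 1) * arrow_elt n (j - 1) j
        \<in> (rel_ideal n :: (gen, 'k) free_alg set)" (is "?d \<in> _")
    proof -
      consider "j < n" | "j = n" | "n < j" by linarith
      then show ?thesis
      proof cases
        case 1
        let ?r = "g_elt j (j+1) * g_elt (j+1) j + g_elt j (j-1) * g_elt (j-1) j :: (gen, 'k) free_alg"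
        have "?r \<in> rel_ideal n"
          using 1 that by (intro Iq) (auto simp: preproj_rels_def)
        moreover have "?d = ?r \<or> - ?d = ?r"
          using 1 that by (cases "odd j") (auto simp: arrow_elt_def adjacent_def Suc_eq_plus1)
        ultimately show ?thesis using Im[of ?d] by auto
      next
        case 2
        have "g_elt n (n-1) * g_elt (n-1) n \<in> (rel_ideal n :: (gen, 'k) free_alg set)"
          using 2 that by (intro Iq) (auto simp: preproj_rels_def)
        then show ?thesis
          using 2 that Im[of "- (g_elt n (n-1) * g_elt (n-1) n)"] by (auto simp: arrow_elt_def adjacent_def)
      qed (simp add: arrow_elt_def I0)
    qed
  qed simp_all
  show ?thesis
  proof (unfold_locales)
  qed (use n e_e e_h h_e e_x x_e x_x x_h h_12_21 rel_2 rel_j in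
      \<open>auto simp: hom Pi_class_closed[OF n] path_refl path_up path_down arrow_elt_def[of n]\<close>)
qed

section \<open>Reduction to standard monomials\<close>

definition basis_elt :: "nat \<Rightarrow> state \<Rightarrow> (gen, 'k::field) free_alg"
  where "basis_elt n s = (if s \<in> basis n then elt n s else 0)"

lemma basis_elt_closed [simp]: "basis_elt n s \<in> free_carrier n"
  by (simp add: basis_elt_def)

lemma Pi_class_uminus_cong:
  assumes "2 \<le> n" "f \<in> free_carrier n" "g \<in> free_carrier n"
    and "Pi_class n f = (Pi_class n g :: 'k::field Pi_elt)"
  shows "Pi_class n (- f) = (Pi_class n (- g) :: 'k Pi_elt)"
proof -
  have "Pi_class n (- 1 * f) = (Pi_class n (- 1 * g) :: 'k Pi_elt)"
    unfolding Pi_class_mult[OF assms(1) free_carrier_closed(3)[OF free_carrier_closed(5)] assms(2)]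
      Pi_class_mult[OF assms(1) free_carrier_closed(3)[OF free_carrier_closed(5)] assms(3)] assms(4) ..
  then show ?thesis by simp
qed

text \<open>Here the multiplication table becomes a reduction modulo the ideal: the products of
  \<open>WD\<close> and \<open>WU\<close> match the clauses of \<open>gen_act\<close>.\<close>

lemma Pi_class_step:
  assumes n: "2 \<le> n" and s: "s \<in> basis n" and a: "a \<in> gens n"
  shows "Pi_class n (basis_elt n s * gen_elt a) = (Pi_class n (gen_act a (basis_elt n) s) :: 'k::field Pi_elt)"
proof -
  let ?c = "Pi_class n :: _ \<Rightarrow> 'k Pi_elt"
  let ?W = "basis_elt n :: state \<Rightarrow> (gen, 'k) free_alg"
  interpret B_relations "Pi_B n :: 'k Pi_elt ring" n "\<lambda>i. Pi_class n (vert_elt n i)"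
    "\<lambda>i. Pi_class n (nil_elt n i)" "\<lambda>i j. Pi_class n (arrow_elt n i j)" "\<lambda>i j. Pi_class n (path_elt n i j)"
    by (rule B_relations_Pi[OF n])
  have c: "?c (loop_elt n j) = c j" for j
    by (simp add: loop_elt_def c_def Pi_class_mult[OF n])
  have X: "?c (nil_pow n j \<epsilon>) = X j \<epsilon>" for j \<epsilon>
    by (simp add: nil_pow_def X_def Pi_class_one[OF n])
  have elt_D: "?c (elt n (Direct i j \<epsilon> p)) = WD i j \<epsilon> p" for i j \<epsilon> p
    by (simp add: WD_def Pi_class_mult[OF n] Pi_class_power[OF n] c X)
  have elt_U: "?c (elt n (Detour i j \<epsilon> p)) = WU i j \<epsilon> p" for i j \<epsilon> p
    by (simp add: WU_def Pi_class_mult[OF n] Pi_class_power[OF n] c X)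
  \<comment> \<open>True also above height \<open>n\<close>, where both sides vanish;
    \<open>move\<close> can produce such indices.\<close>
  have W_D: "?c (?W (Direct i j \<epsilon> p)) = WD i j \<epsilon> p"
    if "shape (Direct i j \<epsilon> p)" "i \<le> n" "j \<le> n" for i j \<epsilon> p
    using that by (auto simp: basis_elt_def basis_def Pi_class_zero[OF n] not_le WD_overflow simp del: elt.simps simp add: elt_D)
  have W_U: "?c (?W (Detour i j \<epsilon> p)) = WU i j \<epsilon> p"
    if "shape (Detour i j \<epsilon> p)" "i \<le> n" "j \<le> n" for i j \<epsilon> p
    using that by (auto simp: basis_elt_def basis_def Pi_class_zero[OF n] not_le WU_overflow simp del: elt.simps simp add: elt_U)
  note basisD[OF s]
  show ?thesis
  proof (cases a)
    case (Vert k)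
    then have "gen_elt a = (vert_elt n k :: (gen, 'k) free_alg)" using a by (simp add: vert_elt_def)
    then have "?c (?W s * gen_elt a) = ?c (?W s) \<otimes>\<^bsub>Pi_B n\<^esub> ?c (vert_elt n k)"
      by (simp add: Pi_class_mult[OF n])
    also have "\<dots> = (if tgt s = k then ?c (?W s) else \<zero>\<^bsub>Pi_B n\<^esub>)"
      using \<open>src s \<in> {1..n}\<close> \<open>tgt s \<in> {1..n}\<close> \<open>shape s\<close>
      by (cases s) (auto simp: W_D W_U WD_e WU_e W_e_other)
    finally show ?thesis using Vert \<open>shape s\<close> by (simp add: Pi_class_zero[OF n])
  next
    case (Loop k)
    then have k: "gen_elt a = (nil_elt n k :: (gen, 'k) free_alg)" "2 \<le> k" using a by (simp_all add: nil_elt_def)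
    then have "?c (?W s * gen_elt a) = ?c (?W s) \<otimes>\<^bsub>Pi_B n\<^esub> ?c (nil_elt n k)"
      by (simp add: Pi_class_mult[OF n])
    also have "\<dots> = (if tgt s = k then ?c (loop ?W s) else \<zero>\<^bsub>Pi_B n\<^esub>)"
      using \<open>src s \<in> {1..n}\<close> \<open>tgt s \<in> {1..n}\<close> \<open>shape s\<close> k
      by (cases s) (auto simp: W_D W_U W_x W_other e_x Pi_class_zero[OF n])
    finally show ?thesis using Loop \<open>shape s\<close> k by (simp add: Pi_class_zero[OF n])
  next
    case (Arr j k)
    then have jk: "j \<in> {1..n}" "k \<in> {1..n}" "adjacent j k" using a by simp_all
    have move_closed: "move ?W s k \<in> free_carrier n" by (cases s) simp_all
    have "?c (?W s * arrow_elt n j k) = ?c (?W s) \<otimes>\<^bsub>Pi_B n\<^esub> ?c (arrow_elt n j k)"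
      by (simp add: Pi_class_mult[OF n])
    also have "\<dots> = (if tgt s = j then ?c (move ?W s k) else \<zero>\<^bsub>Pi_B n\<^esub>)"
    proof (cases "tgt s = j")
      case False
      then show ?thesis
        using \<open>src s \<in> {1..n}\<close> \<open>tgt s \<in> {1..n}\<close> \<open>shape s\<close>
        by (cases s) (auto simp: W_D W_U W_other e_h)
    next
      case True
      consider "k = 1" "j = 2" | "j = 1" "k = 2" | "2 \<le> j" "2 \<le> k"
        using jk unfolding adjacent_def atLeastAtMost_iff by linarith
      then have "?c (?W s) \<otimes>\<^bsub>Pi_B n\<^esub> ?c (arrow_elt n j k) = ?c (move ?W s k)"
      proof cases
        case 1
        then show ?thesis
          using \<open>src s \<in> {1..n}\<close> \<open>tgt s \<in> {1..n}\<close> \<open>shape s\<close> True jk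
          by (cases s) (auto simp: W_D W_U WD_21 WU_21 Pi_class_zero[OF n])
      next
        case 2
        show ?thesis
        proof (cases s)
          case (Direct i j' \<epsilon> p)
          \<comment> \<open>\<open>WD_12\<close> is stated as a sum, so the detour is added to both
            sides and then cancelled.\<close>
          have "?c (?W (Direct i 2 False (Suc p))) = ?c (move ?W s k) \<oplus>\<^bsub>Pi_B n\<^esub> ?c (?W (Detour i 2 True p))"
            using Direct True 2 move_closed by (simp flip: Pi_class_add[OF n])
          then have "?c (?W s) \<otimes>\<^bsub>Pi_B n\<^esub> ?c (arrow_elt n 1 2) \<oplus>\<^bsub>Pi_B n\<^esub> ?c (?W (Detour i 2 True p))
              = ?c (move ?W s k) \<oplus>\<^bsub>Pi_B n\<^esub> ?c (?W (Detour i 2 True p))"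
            using \<open>src s \<in> {1..n}\<close> \<open>tgt s \<in> {1..n}\<close> \<open>shape s\<close> True 2 Direct jk
            by (simp add: W_D W_U WD_12)
          then show ?thesis using 2 move_closed by (simp add: Pi_class_closed[OF n])
        next
          case (Detour i j' \<epsilon> p)
          then show ?thesis
            using \<open>src s \<in> {1..n}\<close> \<open>tgt s \<in> {1..n}\<close> \<open>shape s\<close> True 2 jk
            by (simp add: W_U WU_12)
        qed
      next
        case 3
        then show ?thesis
          using \<open>src s \<in> {1..n}\<close> \<open>tgt s \<in> {1..n}\<close> \<open>shape s\<close> True jk
          by (cases s) (auto simp: W_D W_U WD_h WU_h)
      qed
      then show ?thesis using True by simp
    qed
    finally have "?c (?W s * arrow_elt n j k) = ?c (if tgt s = j then move ?W s k else 0)"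
      by (simp add: Pi_class_zero[OF n])
    \<comment> \<open>The negated form serves downward arrows out of odd vertices, where
      \<open>arrow_elt\<close> is minus the generator.\<close>
    moreover from this have "?c (- (?W s * arrow_elt n j k)) = ?c (- (if tgt s = j then move ?W s k else 0))"
      using move_closed by (intro Pi_class_uminus_cong[OF n]) auto
    ultimately show ?thesis
      using Arr jk \<open>shape s\<close> by (auto simp: arrow_elt_def split: if_splits)
  qed
qed

section \<open>Coordinates with respect to the standard monomials\<close>

definition start :: "nat \<Rightarrow> state"
  where "start i = (if i = 1 then Detour 1 1 False 0 else Direct i i False 0)"

definition delta :: "state \<Rightarrow> state \<Rightarrow> 'k::zero_neq_one"
  where "delta b s = (if s = b then 1 else 0)"

text \<open>The coefficient of \<open>b\<close> in the reduction of \<open>f\<close>. Multiplication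
  preserves the source, so the only idempotent to start from is the one at
  \<open>src b\<close>.\<close>

definition coord :: "(gen, 'k::field) free_alg \<Rightarrow> state \<Rightarrow> 'k"
  where "coord f b = act f (delta b) (start (src b))"

definition comb :: "nat \<Rightarrow> state set \<Rightarrow> (state \<Rightarrow> 'k::field) \<Rightarrow> (gen, 'k) free_alg"
  where "comb n S a = (\<Sum>b\<in>S. Poly_Mapping.single 0 (a b) * elt n b)"

lemma comb_closed [simp]: "comb n S a \<in> free_carrier n"
  by (auto simp: comb_def intro!: free_carrier_sum)

lemma finite_basis [simp]: "finite (basis n)"
proof (rule finite_subset)
  let ?A = "{..n} \<times> {..n} \<times> (UNIV :: bool set) \<times> {..n}"
  show "basis n \<subseteq> (\<lambda>(i, j, \<epsilon>, p). Direct i j \<epsilon> p) ` ?A \<union> (\<lambda>(i, j, \<epsilon>, p). Detour i j \<epsilon> p) ` ?A"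
  proof
    fix s assume s: "s \<in> basis n"
    show "s \<in> (\<lambda>(i, j, \<epsilon>, p). Direct i j \<epsilon> p) ` ?A \<union> (\<lambda>(i, j, \<epsilon>, p). Detour i j \<epsilon> p) ` ?A"
    proof (cases s)
      case (Direct i j \<epsilon> p)
      then have "(i, j, \<epsilon>, p) \<in> ?A" using s by (auto simp: basis_def)
      from imageI[OF this, of "\<lambda>(i, j, \<epsilon>, p). Direct i j \<epsilon> p"] show ?thesis using Direct by simp
    next
      case (Detour i j \<epsilon> p)
      then have "(i, j, \<epsilon>, p) \<in> ?A" using s by (auto simp: basis_def)
      from imageI[OF this, of "\<lambda>(i, j, \<epsilon>, p). Detour i j \<epsilon> p"] show ?thesis using Detour by simp
    qed
  qed
  show "finite ((\<lambda>(i, j, \<epsilon>, p). Direct i j \<epsilon> p) ` ?A \<union> (\<lambda>(i, j, \<epsilon>, p). Detour i j \<epsilon> p) ` ?A)"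
    by simp
qed

lemma delta_supp_fun: "b \<in> basis n \<Longrightarrow> delta b \<in> supp_fun n"
  by (auto simp: delta_def supp_fun_def)

lemma free_carrier_single: "set (letters w) \<subseteq> gens n \<Longrightarrow> Poly_Mapping.single w c \<in> free_carrier n"
  by (simp add: mem_carrier_free_algebra)

text \<open>Lets values be replaced by congruent ones inside \<open>gen_act\<close>, as the
  reduction of a word letter by letter requires.\<close>

lemma gen_act_cong:
  assumes n: "2 \<le> n" and "\<And>s. \<phi> s \<in> free_carrier n" "\<And>s. \<psi> s \<in> free_carrier n"
    and eq: "\<And>s. Pi_class n (\<phi> s) = (Pi_class n (\<psi> s) :: 'k::field Pi_elt)"
  shows "Pi_class n (gen_act a \<phi> s) = (Pi_class n (gen_act a \<psi> s) :: 'k Pi_elt)"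
proof -
  have minus: "Pi_class n (\<phi> s - \<phi> t) = (Pi_class n (\<psi> s - \<psi> t) :: 'k Pi_elt)" for s t
    using assms Pi_class_uminus_cong[OF n assms(2,3) eq]
      Pi_class_add[OF n, of "\<phi> s" "- \<phi> t"] Pi_class_add[OF n, of "\<psi> s" "- \<psi> t"] by simp
  have "Pi_class n (loop \<phi> s) = (Pi_class n (loop \<psi> s) :: 'k Pi_elt)" by (cases s) (simp_all add: eq)
  moreover have "Pi_class n (move \<phi> s k) = (Pi_class n (move \<psi> s k) :: 'k Pi_elt)" for k
    by (cases s) (simp_all add: eq minus)
  moreover have "move \<phi> s k \<in> free_carrier n" "move \<psi> s k \<in> free_carrier n" for k
    using assms by (cases s; simp)+
  moreover from calculation
  have "Pi_class n (- move \<phi> s k) = (Pi_class n (- move \<psi> s k) :: 'k Pi_elt)" for k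
    by (intro Pi_class_uminus_cong[OF n])
  ultimately show ?thesis
    by (cases a) (simp_all add: eq)
qed

lemma word_act_closed:
  assumes "\<And>s. \<phi> s \<in> (free_carrier n :: (gen, 'k::field) free_alg set)"
  shows "word_act w \<phi> s \<in> free_carrier n"
proof (induction w arbitrary: s rule: word_induct)
  case (gen a w)
  have "loop (word_act w \<phi>) s \<in> free_carrier n" "move (word_act w \<phi>) s k \<in> free_carrier n" for k
    using gen by (cases s; simp)+
  then show ?case using gen by (cases a) (simp_all add: word_act_add)
qed (simp add: assms)

lemma basis_elt_supp_fun: "basis_elt n \<in> supp_fun n"
  by (simp add: basis_elt_def supp_fun_def)

text \<open>The first letter is reduced by \<open>Pi_class_step\<close>. Naturality for right
  multiplication by the remaining word moves that word onto each resulting monomial, where the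
  induction hypothesis applies.\<close>

lemma Pi_class_word:
  assumes n: "2 \<le> n" and w: "set (letters w) \<subseteq> gens n"
  shows "Pi_class n (basis_elt n s * Poly_Mapping.single w 1)
    = (Pi_class n (word_act w (basis_elt n) s) :: 'k::field Pi_elt)"
  using w
proof (induction w arbitrary: s rule: word_induct)
  case (gen a w)
  let ?W = "basis_elt n :: state \<Rightarrow> (gen, 'k) free_alg" and ?w = "Poly_Mapping.single w 1 :: (gen, 'k) free_alg"
  have a: "a \<in> gens n" and w: "set (letters w) \<subseteq> gens n"
    using gen.prems by (simp_all add: plus_free_monoid_def)
  have wc: "?w \<in> free_carrier n" using w by (simp add: mem_carrier_free_algebra)
  have *: "Poly_Mapping.single (Word [a] + w) 1 = gen_elt a * ?w"
    by (simp add: gen_elt_def mult_single)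
  show ?case
  proof (cases "s \<in> basis n")
    case True
    have gc: "gen_act a ?W s \<in> free_carrier n"
      using word_act_closed[of ?W n "Word [a]" s] by simp
    have "Pi_class n (?W s * Poly_Mapping.single (Word [a] + w) 1)
        = Pi_class n (?W s * gen_elt a) \<otimes>\<^bsub>Pi_B n\<^esub> (Pi_class n ?w :: 'k Pi_elt)"
      using a wc by (simp add: * Pi_class_mult[OF n, symmetric] mult.assoc)
    also have "\<dots> = Pi_class n (gen_act a ?W s * ?w)"
      using wc gc by (simp add: Pi_class_step[OF n True a] Pi_class_mult[OF n])
    also have "gen_act a ?W s * ?w = gen_act a (\<lambda>s. ?W s * ?w) s"
      by (rule gen_act_natural[symmetric]) (simp add: additive_def distrib_right)
    also have "Pi_class n \<dots> = (Pi_class n (gen_act a (word_act w ?W) s) :: 'k Pi_elt)"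
      using gen.IH w wc by (intro gen_act_cong[OF n]) (simp_all add: word_act_closed)
    finally show ?thesis by (simp add: word_act_add)
  next
    case False
    then have "word_act (Word [a] + w) ?W s = 0"
      using word_act_supp_fun[OF basis_elt_supp_fun, of "Word [a] + w" n]
      by (auto simp: supp_fun_def)
    moreover have "?W s = 0" using False by (simp add: basis_elt_def)
    ultimately show ?thesis by simp
  qed
qed simp

text \<open>The bridge between the two kinds of values: \<open>basis_elt n\<close> is the sum of the
  functions \<open>delta b\<close> times their monomials, and multiplying a scalar into a monomial
  is additive.\<close>

lemma word_act_basis_elt:
  "word_act w (basis_elt n) s = (comb n (basis n) (\<lambda>b. word_act w (delta b) s) :: (gen, 'k::field) free_alg)"
proof -
  have "basis_elt n = (\<lambda>s. \<Sum>b\<in>basis n. Poly_Mapping.single 0 (delta b s) * elt n b :: (gen, 'k) free_alg)"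
  proof
    fix s
    have "(\<Sum>b\<in>basis n. Poly_Mapping.single 0 (delta b s) * elt n b :: (gen, 'k) free_alg)
      = (\<Sum>b\<in>basis n. if s = b then elt n s else 0)"
      by (intro sum.cong) (auto simp: delta_def)
    then show "basis_elt n s = (\<Sum>b\<in>basis n. Poly_Mapping.single 0 (delta b s) * elt n b :: (gen, 'k) free_alg)"
      by (simp add: basis_elt_def)
  qed
  moreover have "word_act w (\<lambda>s. Poly_Mapping.single 0 (delta b s) * elt n b :: (gen, 'k) free_alg) s
      = Poly_Mapping.single 0 (word_act w (delta b) s) * elt n b" for b
    by (rule word_act_natural) (simp add: additive_def single_add distrib_right)
  ultimately show ?thesis by (simp add: word_act_sum comb_def)
qed

lemma single_0_mult:
  fixes f :: "(gen, 'k::field) free_alg"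
  shows "Poly_Mapping.single 0 c * f = f * Poly_Mapping.single 0 c"
  by (induction f rule: poly_mapping_add_induct)
    (simp_all add: mult_single distrib_left distrib_right mult.commute)

lemma comb_add: "comb n S (\<lambda>b. f b + g b) = comb n S f + comb n S g"
  by (simp add: comb_def single_add distrib_right sum.distrib)

lemma comb_scale: "comb n S (\<lambda>b. c * f b) = Poly_Mapping.single 0 c * comb n S f"
  by (simp add: comb_def sum_distrib_left mult_single flip: mult.assoc)

lemma comb_zero [simp]: "comb n S (\<lambda>b. 0) = 0"
  by (simp add: comb_def)

lemma poly_mapping_sum_single:
  fixes f :: "'a \<Rightarrow>\<^sub>0 'b::comm_monoid_add"
  shows "(\<Sum>w\<in>Poly_Mapping.keys f. Poly_Mapping.single w (Poly_Mapping.lookup f w)) = f"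
proof (rule poly_mapping_eqI)
  fix k
  have "(\<Sum>w\<in>Poly_Mapping.keys f. Poly_Mapping.lookup (Poly_Mapping.single w (Poly_Mapping.lookup f w)) k)
    = (\<Sum>w\<in>Poly_Mapping.keys f. if w = k then Poly_Mapping.lookup f w else 0)"
    by (intro sum.cong) (auto simp: lookup_single when_def)
  then show "Poly_Mapping.lookup (\<Sum>w\<in>Poly_Mapping.keys f. Poly_Mapping.single w (Poly_Mapping.lookup f w)) k
    = Poly_Mapping.lookup f k"
    by (simp add: lookup_sum in_keys_iff)
qed

lemma Pi_class_basis_elt_mult:
  assumes n: "2 \<le> n" and f: "f \<in> free_carrier n"
  shows "Pi_class n (basis_elt n s * f)
    = (Pi_class n (comb n (basis n) (\<lambda>b. act f (delta b) s)) :: 'k::field Pi_elt)"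
proof -
  \<comment> \<open>Induction over finite sets of words, rather than over \<open>f\<close>, keeps
    all words inside \<open>gens n\<close>.\<close>
  let ?f = "\<lambda>A. \<Sum>w\<in>A. Poly_Mapping.single w (Poly_Mapping.lookup f w)"
  have "Pi_class n (basis_elt n s * ?f A)
      = (Pi_class n (comb n (basis n) (\<lambda>b. act (?f A) (delta b) s)) :: 'k Pi_elt)"
    if "finite A" "\<And>w. w \<in> A \<Longrightarrow> set (letters w) \<subseteq> gens n" for A
    using that
  proof (induction A rule: finite_induct)
    case (insert w A)
    let ?k = "Poly_Mapping.lookup f w" and ?w = "Poly_Mapping.single w 1 :: (gen, 'k) free_alg"
    let ?g = "comb n (basis n) (\<lambda>b. word_act w (delta b) s) :: (gen, 'k) free_alg"
    have wc: "?w \<in> free_carrier n" and Ac: "?f A \<in> free_carrier n"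
      using insert.prems by (auto intro!: free_carrier_sum free_carrier_single)
    have "Poly_Mapping.single w ?k = Poly_Mapping.single 0 ?k * ?w"
      by (simp add: mult_single)
    then have "basis_elt n s * Poly_Mapping.single w ?k = Poly_Mapping.single 0 ?k * (basis_elt n s * ?w)"
      by (metis (no_types) mult.assoc single_0_mult)
    then have "Pi_class n (basis_elt n s * Poly_Mapping.single w ?k)
        = Pi_class n (Poly_Mapping.single 0 ?k) \<otimes>\<^bsub>Pi_B n\<^esub> (Pi_class n (basis_elt n s * ?w) :: 'k Pi_elt)"
      using wc Pi_class_mult[OF n, of "Poly_Mapping.single 0 ?k" "basis_elt n s * ?w"] by simp
    also have "Pi_class n (basis_elt n s * ?w) = (Pi_class n ?g :: 'k Pi_elt)"
      using Pi_class_word[OF n, of w s] insert.prems by (simp add: word_act_basis_elt)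
    finally have "Pi_class n (basis_elt n s * Poly_Mapping.single w ?k)
        = (Pi_class n (Poly_Mapping.single 0 ?k * ?g) :: 'k Pi_elt)"
      by (simp add: Pi_class_mult[OF n])
    moreover have "basis_elt n s * Poly_Mapping.single w ?k \<in> free_carrier n"
      using insert.prems by (auto intro!: free_carrier_closed(2) free_carrier_single)
    ultimately show ?case
      using insert wc Ac
      by (simp add: distrib_left Pi_class_add[OF n] act_add act_single comb_add comb_scale)
  qed (simp add: Pi_class_mult[OF n])
  from this[of "Poly_Mapping.keys f"] f show ?thesis
    by (simp add: poly_mapping_sum_single mem_carrier_free_algebra)
qed

text \<open>Arrows touching the vertex 1 have \<open>x\<close>-degree 0; hence
  \<open>max 2 j\<close>, and the truncated \<open>i - 2\<close> and \<open>j - 2\<close> for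
  detours. Each loop contributes \<open>(2, 1)\<close>.\<close>

fun bideg :: "state \<Rightarrow> nat \<times> rat" where
  "bideg (Direct i j \<epsilon> p) = ((i - j) + (j - i) + 2 * p,
     of_nat ((i - max 2 j) + (max 2 j - i)) / 2 + of_nat p + of_bool \<epsilon>)"
| "bideg (Detour i j \<epsilon> p) = ((i - 1) + (j - 1) + 2 * p,
     of_nat ((i - 2) + (j - 2)) / 2 + of_nat p + of_bool \<epsilon>)"

text \<open>In terms of indices: multiplying by \<open>a\<close> keeps the source and shifts the
  bidegree by that of \<open>a\<close>, so only values at such indices enter.\<close>

lemma gen_act_graded:
  assumes "\<And>t. src t = src s \<Longrightarrow> bideg t = bideg s + gen_bideg a \<Longrightarrow> \<phi> t = 0"
  shows "gen_act a \<phi> s = 0"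
proof (cases a)
  case (Vert k)
  then show ?thesis using assms by (simp add: zero_prod_def[symmetric])
next
  case (Loop k)
  have "loop \<phi> s = 0" if "shape s" "tgt s = k"
    using that by (cases s) (auto intro!: assms simp: Loop)
  then show ?thesis using Loop by simp
next
  case (Arr j k)
  have "move \<phi> s k = 0" if "shape s" "tgt s = j" "adjacent j k" "1 \<le> k"
  proof (cases s)
    case (Direct i j' \<epsilon> p)
    have "\<phi> (Direct i 2 False (Suc p)) = 0" "\<phi> (Detour i 2 True p) = 0" if "j = 1" "k = 2" "1 < i" "\<epsilon>"
      using Direct that \<open>tgt s = j\<close> by (auto intro!: assms simp: Arr)
    then show ?thesis
      using Direct that
      by (auto intro!: assms simp: Arr adjacent_def max_def of_nat_diff field_simps)
  next
    case (Detour i j' \<epsilon> p)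
    then show ?thesis
      using that
      by (auto intro!: assms simp: Arr adjacent_def of_nat_diff field_simps)
  qed
  then show ?thesis using Arr by simp
qed

lemma word_bideg_gen_plus: "word_bideg (Word [a] + w) = gen_bideg a + word_bideg w"
  by (simp add: word_bideg_def plus_free_monoid_def)

lemma word_bideg_plus: "word_bideg (v + w) = word_bideg v + word_bideg w"
  by (simp add: word_bideg_def plus_free_monoid_def)

lemma word_act_graded:
  "(\<And>t. src t = src s \<Longrightarrow> bideg t = bideg s + word_bideg w \<Longrightarrow> \<phi> t = 0) \<Longrightarrow> word_act w \<phi> s = 0"
proof (induction w arbitrary: s rule: word_induct)
  case zero
  moreover have "word_bideg 0 = 0" by (simp add: word_bideg_def zero_free_monoid_def)
  ultimately show ?case by simp
next
  case (gen a w)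
  show ?case
    unfolding word_act_add word_act_single
    by (intro gen_act_graded gen.IH gen.prems) (simp_all add: word_bideg_gen_plus add.assoc)
qed

definition homog :: "(gen, 'k::field) free_alg \<Rightarrow> nat \<times> rat \<Rightarrow> bool"
  where "homog f d \<longleftrightarrow> (\<forall>w\<in>Poly_Mapping.keys f. word_bideg w = d)"

lemma act_homog:
  assumes "homog f d" "\<And>t. src t = src s \<Longrightarrow> bideg t = bideg s + d \<Longrightarrow> \<phi> t = 0"
  shows "act f \<phi> s = 0"
  unfolding act_def
proof (intro sum.neutral ballI)
  fix w assume "w \<in> Poly_Mapping.keys f"
  then have "word_bideg w = d" using assms(1) by (simp add: homog_def)
  then have "word_act w \<phi> s = 0" using assms(2) by (intro word_act_graded) simp
  then show "Poly_Mapping.lookup f w * word_act w \<phi> s = 0" by simp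
qed

lemma act_src:
  assumes "\<And>t. src t = src s \<Longrightarrow> \<phi> t = 0"
  shows "act f \<phi> s = 0"
  unfolding act_def using assms by (auto intro!: sum.neutral word_act_graded)

lemma bideg_start: "1 \<le> i \<Longrightarrow> bideg (start i) = 0"
  by (auto simp: start_def zero_prod_def max_def)

lemma src_start [simp]: "src (start i) = i" and tgt_start [simp]: "tgt (start i) = i"
  by (simp_all add: start_def)

lemma start_basis: "i \<in> {1..n} \<Longrightarrow> start i \<in> basis n"
  by (auto simp: start_def basis_def)

lemma coord_homog:
  assumes "homog f d" "b \<in> basis n" "bideg b \<noteq> d"
  shows "coord f b = 0"
  unfolding coord_def
  using assms basisD(1)[OF assms(2)] by (intro act_homog) (auto simp: bideg_start delta_def)

lemma coord_sum: "coord (\<Sum>i\<in>A. f i) b = (\<Sum>i\<in>A. coord (f i) b)"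
  by (simp add: coord_def act_sum)

lemma coord_scale: "coord (Poly_Mapping.single 0 c * f) b = c * coord f b"
  by (simp add: coord_def act_mult act_single)

section \<open>Coordinates on the quotient\<close>

lemma Pi_class_eqD:
  assumes "2 \<le> n" "f \<in> free_carrier n" "g \<in> free_carrier n"
    and "Pi_class n f = (Pi_class n g :: 'k::field Pi_elt)"
  shows "f - g \<in> rel_ideal n"
proof -
  interpret I: ideal "rel_ideal n :: (gen, 'k) free_alg set" "free_algebra (gens n)"
    by (rule rel_ideal_ideal[OF assms(1)])
  have "f \<in> rel_ideal n +>\<^bsub>free_algebra (gens n)\<^esub> g"
    using I.a_rcos_self[OF assms(2)] assms(4) by (simp add: Pi_class_def)
  then show ?thesis unfolding a_r_coset_def' by auto
qed

text \<open>Two representatives differ by an element of the ideal, which lies in the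
  annihilator.\<close>

lemma coord_Pi_class:
  assumes "2 \<le> n" "f \<in> free_carrier n" "g \<in> free_carrier n" "b \<in> basis n"
    and "Pi_class n f = (Pi_class n g :: 'k::field Pi_elt)"
  shows "coord f b = coord g b"
proof -
  have "f - g \<in> annihilator n"
    using Pi_class_eqD[OF assms(1,2,3,5)] rel_ideal_le_annihilator[OF assms(1)] by blast
  then have "act (f - g) (delta b) = (\<lambda>s. 0)"
    using delta_supp_fun[OF assms(4)] by (auto simp: annihilator_def)
  then show ?thesis by (simp add: coord_def act_diff fun_eq_iff)
qed

lemma sum_starts:
  assumes n: "2 \<le> n"
  shows "Pi_class n (\<Sum>i = 1..n. basis_elt n (start i)) = (Pi_class n 1 :: 'k::field Pi_elt)"
proof (rule Pi_class_eqI[OF n])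
  interpret I: ideal "rel_ideal n :: (gen, 'k) free_alg set" "free_algebra (gens n)"
    by (rule rel_ideal_ideal[OF n])
  \<comment> \<open>The trivial path at 1 is encoded as a detour, so its monomial is
    \<open>e_elt 1 * e_elt 1\<close> and needs a correction by an idempotent relation.\<close>
  have e: "basis_elt n (start i) = e_elt i + (if i = 1 then e_elt 1 * e_elt 1 - e_elt 1 else 0 :: (gen, 'k) free_alg)"
    if "i \<in> {1..n}" for i
    using that start_basis[OF that]
    by (auto simp: basis_elt_def start_def path_refl vert_elt_def nil_pow_def)
  have "(\<Sum>i = 1..n. basis_elt n (start i)) - 1
      = ((\<Sum>i = 1..n. e_elt i) - 1) + (e_elt 1 * e_elt 1 - e_elt 1 :: (gen, 'k) free_alg)"
    using n by (simp add: e sum.distrib)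
  moreover have "(\<Sum>i = 1..n. e_elt i) - 1 \<in> (rel_ideal n :: (gen, 'k) free_alg set)"
    by (rule rel_in_rel_ideal[OF n]) (simp add: path_rels_def)
  moreover have "e_elt 1 * e_elt 1 - e_elt 1 \<in> (rel_ideal n :: (gen, 'k) free_alg set)"
  proof (rule rel_in_rel_ideal[OF n], rule UnI1)
    have "\<exists>i j. e_elt 1 * e_elt 1 - e_elt 1 = (e_elt i * e_elt j - (if i = j then e_elt i else 0) :: (gen, 'k) free_alg)
        \<and> i \<in> {1..n} \<and> j \<in> {1..n}"
      using n by (intro exI[of _ 1]) simp
    then show "e_elt 1 * e_elt 1 - e_elt 1 \<in> (path_rels n :: (gen, 'k) free_alg set)"
      unfolding path_rels_def by blast
  qed
  ultimately show "(\<Sum>i = 1..n. basis_elt n (start i)) - 1 \<in> (rel_ideal n :: (gen, 'k) free_alg set)"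
    using additive_subgroup.a_closed[OF I.is_additive_subgroup] by (simp only: free_algebra_simps)
qed (auto intro: free_carrier_sum)

lemma Pi_class_expand:
  assumes n: "2 \<le> n" and f: "f \<in> free_carrier n"
  shows "Pi_class n f = (Pi_class n (comb n (basis n) (coord f)) :: 'k::field Pi_elt)"
proof -
  interpret R: ring "Pi_B n :: 'k Pi_elt ring" by (rule Pi_B_ring[OF n])
  have "Pi_class n f = Pi_class n 1 \<otimes>\<^bsub>Pi_B n\<^esub> (Pi_class n f :: 'k Pi_elt)"
    using f by (simp add: Pi_class_one[OF n] Pi_class_closed[OF n])
  also have "\<dots> = Pi_class n ((\<Sum>i = 1..n. basis_elt n (start i)) * f)"
    unfolding sum_starts[OF n, symmetric]
    using f by (simp add: Pi_class_mult[OF n] free_carrier_sum)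
  also have "\<dots> = Pi_class n (comb n (basis n) (\<lambda>b. \<Sum>i = 1..n. act f (delta b) (start i)))"
  proof -
    have "Pi_class n ((\<Sum>i\<in>I. basis_elt n (start i)) * f)
        = (Pi_class n (comb n (basis n) (\<lambda>b. \<Sum>i\<in>I. act f (delta b) (start i))) :: 'k Pi_elt)"
      if "finite I" for I
      using that
    proof (induction I rule: finite_induct)
      case (insert i I)
      have "Pi_class n ((\<Sum>i\<in>insert i I. basis_elt n (start i)) * f)
          = Pi_class n (basis_elt n (start i) * f) \<oplus>\<^bsub>Pi_B n\<^esub> (Pi_class n ((\<Sum>i\<in>I. basis_elt n (start i)) * f) :: 'k Pi_elt)"
        using insert.hyps f by (simp add: distrib_right Pi_class_add[OF n] free_carrier_sum)
      then show ?case
        using insert f by (simp add: Pi_class_basis_elt_mult[OF n f] comb_add Pi_class_add[OF n])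
    qed simp
    then show ?thesis by simp
  qed
  also have "comb n (basis n) (\<lambda>b. \<Sum>i = 1..n. act f (delta b) (start i)) = comb n (basis n) (coord f)"
    unfolding comb_def
  proof (rule sum.cong[OF refl])
    fix b assume b: "b \<in> basis n"
    \<comment> \<open>The action preserves the source, so only the summand \<open>i = src b\<close>
      survives.\<close>
    have "(\<Sum>i = 1..n. act f (delta b) (start i)) = (\<Sum>i = 1..n. if src b = i then coord f b else 0)"
      by (intro sum.cong refl) (auto simp: coord_def delta_def intro!: act_src)
    then show "Poly_Mapping.single 0 (\<Sum>i = 1..n. act f (delta b) (start i)) * elt n b
        = Poly_Mapping.single 0 (coord f b) * elt n b"
      using basisD(1)[OF b] by simp
  qed
  finally show ?thesis .
qed

section \<open>Linear independence\<close>

lemma act_vert: "act (vert_elt n i) \<phi> s = (if i \<in> {1..n} \<and> shape s \<and> tgt s = i then \<phi> s else 0)"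
  by (simp add: vert_elt_def)

lemma act_nil: "act (nil_elt n i) \<phi> s = (if i \<in> {2..n} \<and> shape s \<and> tgt s = i then loop \<phi> s else 0)"
  by (simp add: nil_elt_def)

lemma act_arr: "act (arrow_elt n j k) \<phi> s =
    (if j \<in> {1..n} \<and> k \<in> {1..n} \<and> adjacent j k \<and> shape s \<and> tgt s = j then move \<phi> s k else 0)"
  by (simp add: arrow_elt_def act_uminus)

lemma start_simps: "start 1 = Detour 1 1 False 0" "2 \<le> i \<Longrightarrow> start i = Direct i i False 0"
  by (simp_all add: start_def)

lemma act_path_D:
  fixes \<phi> :: "state \<Rightarrow> 'k::field"
  assumes "2 \<le> i" "i \<le> n" "2 \<le> j" "j \<le> n"
  shows "act (path_elt n i j) \<phi> (start i) = \<phi> (Direct i j False 0)"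
proof -
  have up: "i + m \<le> n \<Longrightarrow> act (path_elt n i (i + m)) \<phi> (start i) = \<phi> (Direct i (i + m) False 0)" for m and \<phi> :: "state \<Rightarrow> 'k"
  proof (induction m arbitrary: \<phi>)
    case 0
    then show ?case using assms by (simp add: path_refl act_vert start_simps)
  next
    case (Suc m)
    then show ?case
      using assms by (simp add: path_up act_mult act_arr adjacent_def)
  qed
  have down: "2 \<le> i - m \<Longrightarrow> act (path_elt n i (i - m)) \<phi> (start i) = \<phi> (Direct i (i - m) False 0)" for m and \<phi> :: "state \<Rightarrow> 'k"
  proof (induction m arbitrary: \<phi>)
    case 0
    then show ?case using assms by (simp add: path_refl act_vert start_simps)
  next
    case (Suc m)
    obtain k where k: "i - Suc m = k" "i - m = Suc k" "k < i"
      using Suc.prems by (intro that[of "i - Suc m"]) auto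
    then show ?case
      using assms Suc by (simp add: path_down act_mult act_arr adjacent_def)
  qed
  show ?thesis using up[of "j - i"] down[of "i - j"] assms by (cases "i \<le> j") simp_all
qed

lemma act_path_to_1:
  fixes \<phi> :: "state \<Rightarrow> 'k::field"
  assumes "2 \<le> n" "1 \<le> i" "i \<le> n"
  shows "act (path_elt n i 1) \<phi> (start i) = \<phi> (Detour i 1 False 0)"
proof (cases "i = 1")
  case True
  then show ?thesis using assms by (simp add: path_refl act_vert start_simps)
next
  case False
  then have "path_elt n i 1 = (path_elt n i 2 * arrow_elt n 2 1 :: (gen, 'k) free_alg)"
    using path_down[of 1 i n] assms by (simp add: Suc_1)
  then show ?thesis
    using assms False by (simp add: act_mult act_arr adjacent_def act_path_D)
qed

lemma act_path_from_1:
  assumes "2 \<le> n" "1 \<le> i" "1 \<le> j" "j \<le> n"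
  shows "act (path_elt n 1 j) \<phi> (Detour i 1 False 0) = \<phi> (Detour i j False 0)"
proof -
  have "1 + m \<le> n \<Longrightarrow> act (path_elt n 1 (1 + m)) \<phi> (Detour i 1 False 0) = \<phi> (Detour i (1 + m) False 0)" for m
  proof (induction m arbitrary: \<phi>)
    case 0
    then show ?case using assms by (simp add: path_refl act_vert)
  next
    case (Suc m)
    then show ?case
      using assms by (simp add: path_up act_mult act_arr adjacent_def)
  qed
  from this[of "j - 1"] show ?thesis using assms by simp
qed

fun lift :: "nat \<Rightarrow> state \<Rightarrow> state" where
  "lift q (Direct i j \<epsilon> p) = Direct i j \<epsilon> (p + q)"
| "lift q (Detour i j \<epsilon> p) = Detour i j \<epsilon> (p + q)"

lemma lift_simps [simp]: "shape (lift q s) = shape s" "tgt (lift q s) = tgt s" "src (lift q s) = src s"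
  by (cases s; simp)+

text \<open>Exactly one of the two moves in the loop raises \<open>p\<close>. From a direct index
  with target 1, the second term of \<open>move\<close> is a detour already carrying the nilpotent
  and is killed by \<open>nil_elt\<close>. At target \<open>n\<close> both sides are zero.\<close>

lemma act_loop:
  fixes \<phi> :: "state \<Rightarrow> 'k::field"
  assumes "2 \<le> n" "\<phi> \<in> supp_fun n" "shape s" "src s \<le> n" "tgt s \<le> n"
  shows "act (loop_elt n (tgt s)) \<phi> s = \<phi> (lift 1 s)"
proof (cases "tgt s = n")
  case True
  then have "loop_elt n (tgt s) = (0 :: (gen, 'k) free_alg)" using assms(1) by (simp add: loop_elt_def arrow_elt_def)
  moreover have "lift 1 s \<notin> basis n" using True by (cases s) (auto simp: basis_def)
  ultimately show ?thesis using assms(2) by (auto simp: supp_fun_def)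
next
  case False
  then show ?thesis
    using assms(1,3,4,5) by (cases s) (auto simp: loop_elt_def act_mult act_arr act_nil adjacent_def Suc_eq_plus1)
qed

lemma act_loop_pow:
  assumes "2 \<le> n" "\<phi> \<in> supp_fun n" "shape s" "src s \<le> n" "tgt s \<le> n"
  shows "act (loop_elt n (tgt s) ^ p) \<phi> s = \<phi> (lift p s)"
  using assms(3-)
proof (induction p arbitrary: s)
  case 0
  then show ?case by (cases s) simp_all
next
  case (Suc p)
  have "act (loop_elt n (tgt s) ^ Suc p) \<phi> s = act (loop_elt n (tgt s) ^ p) \<phi> (lift 1 s)"
    using Suc.prems assms(1,2) by (simp add: act_mult act_loop act_supp_fun)
  also have "\<dots> = \<phi> (lift p (lift 1 s))"
    using Suc.IH[of "lift 1 s"] Suc.prems by simp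
  also have "lift p (lift 1 s) = lift (Suc p) s" by (cases s) simp_all
  finally show ?case .
qed

text \<open>Following the factors of the monomial from the starting index leads to \<open>b\<close>
  alone, with coefficient 1. Taking \<open>\<phi>\<close> to be a \<open>delta\<close> makes the
  coordinates a dual basis.\<close>

lemma act_elt:
  assumes n: "2 \<le> n" and \<phi>: "\<phi> \<in> supp_fun n" and b: "b \<in> basis n"
  shows "act (elt n b) \<phi> (start (src b)) = \<phi> b"
proof (cases b)
  case (Direct i j \<epsilon> p)
  have *: "shape (Direct i j \<epsilon> 0)" "i \<le> n" "j \<le> n" using b Direct by (auto simp: basis_def)
  have "act (elt n b) \<phi> (start i) = act (loop_elt n j ^ p) \<phi> (Direct i j \<epsilon> 0)"
    using * n by (auto simp: Direct act_mult act_path_D act_nil act_arr adjacent_def nil_pow_def)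
  also have "\<dots> = \<phi> b"
    using act_loop_pow[OF n \<phi>, of "Direct i j \<epsilon> 0" p] * Direct by simp
  finally show ?thesis using Direct by simp
next
  case (Detour i j \<epsilon> p)
  have *: "shape (Detour i j \<epsilon> 0)" "i \<le> n" "j \<le> n" using b Detour by (auto simp: basis_def)
  have "act (elt n b) \<phi> (start i) = act (loop_elt n j ^ p) \<phi> (Detour i j \<epsilon> 0)"
    using * n by (auto simp: Detour act_mult act_path_to_1 act_path_from_1 act_nil nil_pow_def)
  also have "\<dots> = \<phi> b"
    using act_loop_pow[OF n \<phi>, of "Detour i j \<epsilon> 0" p] * Detour by simp
  finally show ?thesis using Detour by simp
qed

text \<open>Handles monomials with different sources: a starting index is killed by the idempotent
  of any other vertex.\<close>

lemma elt_src: "\<exists>g. elt n b = vert_elt n (src b) * (g :: (gen, 'k::field) free_alg)"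
proof -
  have path_elt: "\<exists>g. path_elt n i j * f = vert_elt n i * (g :: (gen, 'k) free_alg)" for i j f
    by (auto simp: path_elt_def mult.assoc)
  show ?thesis by (cases b) (simp_all add: mult.assoc path_elt)
qed

lemma coord_elt:
  assumes n: "2 \<le> n" and b: "b \<in> basis n" and b': "b' \<in> basis n"
  shows "coord (elt n b') b = (if b = b' then 1 else 0 :: 'k::field)"
proof (cases "src b = src b'")
  case True
  then show ?thesis
    using act_elt[OF n delta_supp_fun[OF b] b'] by (auto simp: coord_def delta_def)
next
  case False
  obtain g :: "(gen, 'k) free_alg" where "elt n b' = vert_elt n (src b') * g" using elt_src by blast
  then have "coord (elt n b') b = (0 :: 'k)"
    using False by (simp add: coord_def act_mult act_vert)
  then show ?thesis using False by auto
qed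

lemma coord_comb:
  assumes "2 \<le> n" "S \<subseteq> basis n" "b \<in> basis n"
  shows "coord (comb n S a) b = (if b \<in> S then a b else 0)"
proof -
  have "finite S" using assms(2) finite_subset finite_basis by blast
  have "coord (comb n S a) b = (\<Sum>b'\<in>S. a b' * coord (elt n b') b)"
    by (simp add: comb_def coord_sum coord_scale)
  also have "\<dots> = (\<Sum>b'\<in>S. if b = b' then a b' else 0)"
    using assms by (intro sum.cong) (auto simp: coord_elt)
  finally show ?thesis using \<open>finite S\<close> by simp
qed

lemma comb_cong: "(\<And>b. b \<in> S \<Longrightarrow> a b = a' b) \<Longrightarrow> comb n S a = comb n S a'"
  by (simp add: comb_def)

lemma comb_insert:
  "finite S \<Longrightarrow> b \<notin> S \<Longrightarrow> comb n (insert b S) a = Poly_Mapping.single 0 (a b) * elt n b + comb n S a"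
  by (simp add: comb_def)

text \<open>Each insertion extends the span by a line, since the coordinate at \<open>b\<close> is 1
  on the new monomial and 0 on the old span.\<close>

lemma dimension_comb:
  assumes n: "2 \<le> n" and S: "S \<subseteq> basis n"
  shows "ring.dimension (Pi_B n) (card S) (Pi_scalars n) (range (\<lambda>a. Pi_class n (comb n S a)) :: 'k::field Pi_elt set)"
proof -
  interpret R: ring "Pi_B n :: 'k Pi_elt ring" by (rule Pi_B_ring[OF n])
  have "finite S" using S finite_subset finite_basis by blast
  then show ?thesis
    using S
  proof (induction S rule: finite_induct)
    case empty
    have "range (\<lambda>a. Pi_class n (comb n {} a)) = {\<zero>\<^bsub>Pi_B n\<^esub> :: 'k Pi_elt}"
      by (simp add: comb_def Pi_class_zero[OF n])
    then show ?case using R.zero_dim by simp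
  next
    case (insert b S)
    let ?E = "range (\<lambda>a. Pi_class n (comb n S a)) :: 'k Pi_elt set"
    let ?v = "Pi_class n (elt n b) :: 'k Pi_elt"
    have notin: "?v \<notin> ?E"
    proof
      assume "?v \<in> ?E"
      then obtain a where "?v = Pi_class n (comb n S a)" by blast
      then have "coord (elt n b) b = (coord (comb n S a) b :: 'k)"
        using insert.prems by (intro coord_Pi_class[OF n]) auto
      then show False
        using insert.prems insert.hyps by (simp add: coord_elt[OF n] coord_comb[OF n])
    qed
    have "R.line_extension (Pi_scalars n) ?v ?E = range (\<lambda>a. Pi_class n (comb n (insert b S) a))"
    proof (intro subset_antisym subsetI)
      fix y assume "y \<in> R.line_extension (Pi_scalars n) ?v ?E"
      then obtain k a where y: "y = Pi_class n (Poly_Mapping.single 0 k) \<otimes>\<^bsub>Pi_B n\<^esub> ?v \<oplus>\<^bsub>Pi_B n\<^esub> Pi_class n (comb n S a)"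
        unfolding R.line_extension_mem_iff Pi_scalars_def by auto
      have "comb n S (a(b := k)) = comb n S a"
        using insert.hyps by (intro comb_cong) auto
      then have "y = Pi_class n (comb n (insert b S) (a(b := k)))"
        using insert.hyps by (simp add: y comb_insert Pi_class_add[OF n] Pi_class_mult[OF n])
      then show "y \<in> range (\<lambda>a. Pi_class n (comb n (insert b S) a))" by blast
    next
      fix y :: "'k Pi_elt" assume "y \<in> range (\<lambda>a. Pi_class n (comb n (insert b S) a))"
      then obtain a where "y = Pi_class n (comb n (insert b S) a)" by blast
      then have "y = Pi_class n (Poly_Mapping.single 0 (a b)) \<otimes>\<^bsub>Pi_B n\<^esub> ?v \<oplus>\<^bsub>Pi_B n\<^esub> Pi_class n (comb n S a)"
        using insert.hyps by (simp add: comb_insert Pi_class_add[OF n] Pi_class_mult[OF n])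
      then show "y \<in> R.line_extension (Pi_scalars n) ?v ?E"
        unfolding R.line_extension_mem_iff Pi_scalars_def by blast
    qed
    then show ?case
      using R.Suc_dim[OF _ notin insert.IH] insert.prems insert.hyps
      by (simp add: Pi_class_closed[OF n])
  qed
qed

section \<open>Corners and their bihomogeneous parts\<close>

lemma homog_0 [simp]: "homog 0 d"
  by (simp add: homog_def)

lemma homog_1 [simp]: "homog 1 0"
  by (simp add: homog_def word_bideg_def zero_free_monoid_def)

lemma homog_const [simp]: "homog (Poly_Mapping.single 0 c) 0"
  by (simp add: homog_def word_bideg_def zero_free_monoid_def)

lemma homog_uminus [simp]: "homog (- f) d \<longleftrightarrow> homog f d"
  by (simp add: homog_def)

lemma homog_mult: "homog f d \<Longrightarrow> homog g d' \<Longrightarrow> d'' = d + d' \<Longrightarrow> homog (f * g) d''"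
  unfolding homog_def using keys_mult[of f g] by (auto simp: word_bideg_plus)

lemma homog_add: "homog f d \<Longrightarrow> homog g d \<Longrightarrow> homog (f + g) d"
  unfolding homog_def using Poly_Mapping.keys_add[of f g] by blast

lemma homog_sum: "(\<And>i. i \<in> I \<Longrightarrow> homog (f i) d) \<Longrightarrow> homog (\<Sum>i\<in>I. f i) d"
  by (induction I rule: infinite_finite_induct) (simp_all add: homog_add)

lemma homog_gen: "homog (gen_elt a) (gen_bideg a)"
  by (simp add: homog_def gen_elt_def word_bideg_def)

lemma homog_vert: "homog (vert_elt n i) (0, 0)"
  by (auto simp: vert_elt_def intro: homog_gen[of "Vert i", simplified])

lemma homog_nil: "homog (nil_elt n i) (0, 1)"
  by (auto simp: nil_elt_def intro: homog_gen[of "Loop i", simplified])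

lemma homog_arr: "homog (arrow_elt n i j :: (gen, 'k::field) free_alg) (1, if i = 1 \<or> j = 1 then 0 else 1/2)"
proof -
  have "homog (g_elt i j :: (gen, 'k) free_alg) (1, if i = 1 \<or> j = 1 then 0 else 1/2)"
    by (rule homog_gen[of "Arr i j", unfolded gen_bideg.simps])
  then show ?thesis by (auto simp: arrow_elt_def)
qed

lemma homog_path:
  assumes "1 \<le> i" "1 \<le> j"
  shows "homog (path_elt n i j :: (gen, 'k::field) free_alg)
    ((i - j) + (j - i), of_nat ((max 2 i - max 2 j) + (max 2 j - max 2 i)) / 2)"
proof -
  have up: "homog (path_elt n i (i + m) :: (gen, 'k) free_alg) (m, of_nat (max 2 (i + m) - max 2 i) / 2)" for m
  proof (induction m)
    case 0
    then show ?case using homog_vert by (simp add: path_refl)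
  next
    case (Suc m)
    show ?case
      unfolding add_Suc_right
      unfolding path_up[OF le_add1]
      by (rule homog_mult[OF Suc homog_arr])
        (use assms in \<open>auto simp: max_def of_nat_diff field_simps\<close>)
  qed
  have down: "m < i \<Longrightarrow> homog (path_elt n i (i - m) :: (gen, 'k) free_alg) (m, of_nat (max 2 i - max 2 (i - m)) / 2)" for m
  proof (induction m)
    case 0
    then show ?case using homog_vert by (simp add: path_refl)
  next
    case (Suc m)
    obtain k where k: "i - Suc m = k" "i - m = Suc k" "k < i" "1 \<le> k" "i = m + Suc k"
      using Suc.prems by (intro that[of "i - Suc m"]) auto
    have "homog (path_elt n i (Suc k) :: (gen, 'k) free_alg) (m, of_nat (max 2 i - max 2 (Suc k)) / 2)"
      using Suc k by simp
    then show ?case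
      unfolding k(1) path_down[OF k(3)]
      by (rule homog_mult[OF _ homog_arr])
        (use k(4,5) in \<open>auto simp: max_def of_nat_diff field_simps\<close>)
  qed
  show ?thesis
  proof (cases "i \<le> j")
    case True
    then show ?thesis using up[of "j - i"] by simp
  next
    case False
    then have "max 2 j - max 2 i = 0" by simp
    then show ?thesis using down[of "i - j"] False assms by (simp only:) simp
  qed
qed

lemma homog_loop: "1 \<le> j \<Longrightarrow> homog (loop_elt n j) (2, 1)"
  unfolding loop_elt_def
  by (auto intro!: homog_mult[OF homog_arr homog_arr] homog_mult[OF homog_mult[OF homog_arr homog_nil refl] homog_arr])

lemma homog_loop_pow: "1 \<le> j \<Longrightarrow> homog (loop_elt n j ^ p) (2 * p, of_nat p)"
proof (induction p)
  case 0
  show ?case by (auto intro: homog_1[unfolded zero_prod_def])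
qed (auto intro!: homog_mult[OF homog_loop])

lemma homog_nil_pow: "homog (nil_pow n j \<epsilon>) (0, of_bool \<epsilon>)"
  by (auto simp: nil_pow_def intro: homog_nil homog_1[unfolded zero_prod_def])

lemma homog_elt:
  assumes "shape b"
  shows "homog (elt n b :: (gen, 'k::field) free_alg) (bideg b)"
proof (cases b)
  case (Direct i j \<epsilon> p)
  have j: "1 \<le> j" "1 \<le> i" "2 \<le> i" "j = 1 \<Longrightarrow> \<epsilon>" using assms Direct by auto
  show ?thesis
  proof (cases "j = 1")
    case True
    have "homog (path_elt n i 2 * nil_elt n 2 * arrow_elt n 2 1 * loop_elt n 1 ^ p :: (gen, 'k) free_alg) (bideg b)"
      by (rule homog_mult[OF homog_mult[OF homog_mult[OF homog_path homog_nil refl] homog_arr refl] homog_loop_pow])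
        (use j Direct True in \<open>auto simp: max_def\<close>)
    then show ?thesis using Direct True by simp
  next
    case False
    have "homog (path_elt n i j * nil_pow n j \<epsilon> * loop_elt n j ^ p :: (gen, 'k) free_alg) (bideg b)"
      by (rule homog_mult[OF homog_mult[OF homog_path homog_nil_pow refl] homog_loop_pow])
        (use j Direct False in \<open>auto simp: max_def\<close>)
    then show ?thesis using Direct False by simp
  qed
next
  case (Detour i j \<epsilon> p)
  have j: "1 \<le> j" "1 \<le> i" using assms Detour by auto
  have "homog (path_elt n i 1 * path_elt n 1 j * nil_pow n j \<epsilon> * loop_elt n j ^ p :: (gen, 'k) free_alg) (bideg b)"
    by (rule homog_mult[OF homog_mult[OF homog_mult[OF homog_path homog_path refl] homog_nil_pow refl] homog_loop_pow])
      (use j Detour in \<open>auto simp: max_def field_simps\<close>)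
  then show ?thesis using Detour by simp
qed

lemma homog_comb:
  assumes "\<And>b. b \<in> S \<Longrightarrow> shape b \<and> bideg b = d"
  shows "homog (comb n S a) d"
  unfolding comb_def
  using assms homog_elt by (intro homog_sum homog_mult[OF homog_const]) auto

lemma Pi_B_carrier: "y \<in> carrier (Pi_B n) \<longleftrightarrow> (\<exists>h\<in>free_carrier n. y = Pi_class n h)"
  unfolding Pi_B_def FactRing_def Pi_class_def by (auto simp: A_RCOSETS_def')

text \<open>The left idempotent tests the starting index, the right one the target reached.\<close>

lemma coord_corner:
  fixes g :: "(gen, 'k::field) free_alg"
  assumes "b \<in> basis n"
  shows "coord (e_elt i * g * e_elt j) b = (if src b = i \<and> tgt b = j then coord g b else 0)"
proof -
  have "gen_act (Vert j) (delta b) = (if tgt b = j then delta b else (\<lambda>s. 0 :: 'k))"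
    using basisD(3)[OF assms] by (auto simp: delta_def fun_eq_iff)
  moreover have "shape (start (src b))"
    using basisD(1)[OF assms] basisD(3)[OF start_basis, of "src b" n] by simp
  ultimately show ?thesis
    by (simp add: coord_def act_mult act_fun_zero)
qed

definition basis_between :: "nat \<Rightarrow> nat \<Rightarrow> nat \<Rightarrow> state set"
  where "basis_between n i j = {b \<in> basis n. src b = i \<and> tgt b = j}"

text \<open>A class in the intersection has one representative between the idempotents and one that
  is homogeneous. Both have the same coordinates, which therefore vanish outside
  \<open>S\<close>.\<close>

lemma corner_homog:
  fixes n i j d
  defines "S \<equiv> {b \<in> basis_between n i j. bideg b = d}"
  assumes n: "2 \<le> n" and i: "i \<in> {1..n}" and j: "j \<in> {1..n}"
  shows "corner n i j \<inter> Pi_homog n d = (range (\<lambda>a. Pi_class n (comb n S a)) :: 'k::field Pi_elt set)"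
proof -
  have S: "S \<subseteq> basis n" by (auto simp: S_def basis_between_def)
  have comb_S: "comb n (basis n) a = comb n S a" if "\<And>b. b \<in> basis n - S \<Longrightarrow> a b = 0"
    for a :: "state \<Rightarrow> 'k"
    unfolding comb_def using that S by (intro sum.mono_neutral_right) auto
  have class_e: "Pi_class n (e_elt i) \<otimes>\<^bsub>Pi_B n\<^esub> Pi_class n h \<otimes>\<^bsub>Pi_B n\<^esub> Pi_class n (e_elt j)
      = (Pi_class n (e_elt i * h * e_elt j) :: 'k Pi_elt)" if "h \<in> free_carrier n" for h
    using that i j by (simp add: Pi_class_mult[OF n])
  show ?thesis
  proof (intro subset_antisym subsetI)
    fix y :: "'k Pi_elt" assume y: "y \<in> corner n i j \<inter> Pi_homog n d"
    then obtain h where h: "h \<in> free_carrier n" "y = Pi_class n (e_elt i * h * e_elt j)"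
      by (auto simp: corner_def Pi_B_carrier class_e)
    from y obtain f where f: "f \<in> free_carrier n" "homog f d" "y = Pi_class n f"
      by (auto simp: Pi_homog_def homog_def)
    have "coord f b = 0" if b: "b \<in> basis n - S" for b
    proof (cases "bideg b = d")
      case True
      have "coord f b = coord (e_elt i * h * e_elt j) b"
        using b f h i j by (intro coord_Pi_class[OF n]) auto
      then show ?thesis using b True by (auto simp: coord_corner S_def basis_between_def)
    next
      case False
      then show ?thesis using b f by (auto intro: coord_homog)
    qed
    then have "y = Pi_class n (comb n S (coord f))"
      using Pi_class_expand[OF n f(1)] f(3) comb_S[of "coord f"] by simp
    then show "y \<in> range (\<lambda>a. Pi_class n (comb n S a))" by blast
  next
    fix y :: "'k Pi_elt" assume "y \<in> range (\<lambda>a. Pi_class n (comb n S a))"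
    then obtain a where y: "y = Pi_class n (comb n S a)" by blast
    have "homog (comb n S a) d"
      using S by (intro homog_comb) (auto simp: S_def basis_def)
    then have "y \<in> Pi_homog n d"
      using y comb_closed[of n S a] by (auto simp: Pi_homog_def homog_def)
    moreover have "y \<in> corner n i j"
    proof -
      \<comment> \<open>Placing the combination between the idempotents changes none of its
        coordinates, hence not its class.\<close>
      let ?g = "e_elt i * comb n S a * e_elt j"
      have coord_g: "coord ?g b = (if b \<in> S then a b else 0)" if "b \<in> basis n" for b
        using that S by (auto simp: coord_corner coord_comb[OF n] S_def basis_between_def)
      then have "comb n (basis n) (coord ?g) = comb n S (coord ?g)"
        by (intro comb_S) auto
      also have "\<dots> = comb n S a"
        using coord_g S by (intro comb_cong) auto
      finally have "Pi_class n ?g = y"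
        using i j Pi_class_expand[OF n, of ?g] y by simp
      then have "y = Pi_class n (e_elt i) \<otimes>\<^bsub>Pi_B n\<^esub> Pi_class n (comb n S a) \<otimes>\<^bsub>Pi_B n\<^esub> Pi_class n (e_elt j)"
        by (simp add: class_e)
      then show ?thesis
        using Pi_class_closed[OF n comb_closed] unfolding corner_def by blast
    qed
    ultimately show "y \<in> corner n i j \<inter> Pi_homog n d" by blast
  qed
qed

lemma has_hilbert_series_corner:
  assumes n: "2 \<le> n" and "i \<in> {1..n}" "j \<in> {1..n}"
  shows "has_hilbert_series n (corner n i j :: 'k::field Pi_elt set)
    (Poly_Mapping.lookup (\<Sum>b\<in>basis_between n i j. Poly_Mapping.single (bideg b) 1))"
  unfolding has_hilbert_series_def
proof
  fix d
  let ?S = "{b \<in> basis_between n i j. bideg b = d}"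
  have fin: "finite (basis_between n i j)" by (simp add: basis_between_def)
  have "Poly_Mapping.lookup (\<Sum>b\<in>basis_between n i j. Poly_Mapping.single (bideg b) 1) d
      = (\<Sum>b\<in>basis_between n i j. if bideg b = d then 1 else (0 :: nat))"
    unfolding lookup_sum by (intro sum.cong) (auto simp: lookup_single when_def)
  also have "\<dots> = card ?S"
    using fin by (simp add: sum.If_cases Int_def)
  finally show "ring.dimension (Pi_B n)
      (Poly_Mapping.lookup (\<Sum>b\<in>basis_between n i j. Poly_Mapping.single (bideg b) 1) d)
      (Pi_scalars n) (corner n i j \<inter> Pi_homog n d :: 'k Pi_elt set)"
    unfolding corner_homog[OF assms] using dimension_comb[OF n, of ?S]
    by (auto simp: basis_between_def)
qed

section \<open>Polynomials in \<open>t\<close> and fractional powers of \<open>s\<close>\<close>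

lemma ts_monom: "t_pow a * s_pow b = Poly_Mapping.single (a, b) 1" "s_pow b * t_pow a = Poly_Mapping.single (a, b) 1"
  by (simp_all add: t_pow_def s_pow_def mult_single)

text \<open>The factor \<open>1 + s_pow 1\<close> records the flag of the nilpotent, the geometric
  sum the exponent of the loop.\<close>

lemma series_expand:
  "Poly_Mapping.single (a, c) 1 * (1 + s_pow 1) * (\<Sum>p = 0..N. s_pow (of_nat p) * t_pow (2 * p))
    = (\<Sum>\<epsilon>\<in>UNIV. \<Sum>p = 0..N. Poly_Mapping.single (a + 2 * p, c + of_nat p + of_bool \<epsilon>) 1)"
proof -
  have "Poly_Mapping.single (a, c) 1 * (1 + s_pow 1)
      = (\<Sum>\<epsilon>\<in>UNIV. Poly_Mapping.single (a, c + of_bool \<epsilon>) (1 :: nat))"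
    by (simp add: UNIV_bool distrib_left s_pow_def mult_single add.commute)
  then show ?thesis
    by (simp add: ts_monom sum_product mult_single add_ac)
qed

lemma sum_image_pairs:
  assumes "inj (\<lambda>(\<epsilon>, p). F \<epsilon> p)"
  shows "(\<Sum>b\<in>(\<lambda>(\<epsilon>, p). F \<epsilon> p) ` (UNIV \<times> {0..N}). f b) = (\<Sum>\<epsilon>\<in>(UNIV :: bool set). \<Sum>p = 0..(N::nat). f (F \<epsilon> p))"
  using assms by (subst sum.reindex) (auto simp: sum.cartesian_product inj_on_def split_def)

lemma pairs_image:
  "(\<lambda>(\<epsilon>, p). F \<epsilon> p) ` (UNIV \<times> {0..N}) = {F \<epsilon> p | \<epsilon> p. p \<le> (N::nat)}"
proof (intro subset_antisym subsetI)
  fix b assume "b \<in> {F \<epsilon> p | \<epsilon> p. p \<le> N}"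
  then obtain \<epsilon> p where "b = F \<epsilon> p" "(\<epsilon>, p) \<in> UNIV \<times> {0..N}" by auto
  then show "b \<in> (\<lambda>(\<epsilon>, p). F \<epsilon> p) ` (UNIV \<times> {0..N})" by force
next
  fix b assume "b \<in> (\<lambda>(\<epsilon>, p). F \<epsilon> p) ` (UNIV \<times> {0..N})"
  then obtain \<epsilon> p where "b = F \<epsilon> p" "p \<le> N" by auto
  then show "b \<in> {F \<epsilon> p | \<epsilon> p. p \<le> N}" by blast
qed

section \<open>Generating functions\<close>

lemma basis_between_ge_2:
  assumes "i \<in> {2..n}" "j \<in> {2..n}"
  shows "basis_between n i j = (\<lambda>(\<epsilon>, p). Direct i j \<epsilon> p) ` (UNIV \<times> {0..n - max i j})
    \<union> (\<lambda>(\<epsilon>, p). Detour i j \<epsilon> p) ` (UNIV \<times> {0..n - max i j})"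
proof (rule Set.set_eqI)
  fix b
  show "b \<in> basis_between n i j \<longleftrightarrow> b \<in> (\<lambda>(\<epsilon>, p). Direct i j \<epsilon> p) ` (UNIV \<times> {0..n - max i j})
      \<union> (\<lambda>(\<epsilon>, p). Detour i j \<epsilon> p) ` (UNIV \<times> {0..n - max i j})"
    unfolding pairs_image using assms
    by (cases b) (simp_all add: basis_between_def basis_def le_diff_conv2, auto)
qed

lemma basis_between_1_left:
  assumes "j \<in> {2..n}"
  shows "basis_between n 1 j = (\<lambda>(\<epsilon>, p). Detour 1 j \<epsilon> p) ` (UNIV \<times> {0..n - j})"
proof (rule Set.set_eqI)
  fix b
  show "b \<in> basis_between n 1 j \<longleftrightarrow> b \<in> (\<lambda>(\<epsilon>, p). Detour 1 j \<epsilon> p) ` (UNIV \<times> {0..n - j})"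
    unfolding pairs_image using assms
    by (cases b) (simp_all add: basis_between_def basis_def le_diff_conv2 max_def, auto)
qed

text \<open>At target 1 the kind of index determines the flag, so the two kinds merge into one
  family over both flags and produce a single factor \<open>1 + s_pow 1\<close>.\<close>

lemma basis_between_1_right:
  assumes "i \<in> {2..n}"
  shows "basis_between n i 1
    = (\<lambda>(\<epsilon>, p). if \<epsilon> then Direct i 1 True p else Detour i 1 False p) ` (UNIV \<times> {0..n - i})"
proof (rule Set.set_eqI)
  fix b
  show "b \<in> basis_between n i 1 \<longleftrightarrow>
      b \<in> (\<lambda>(\<epsilon>, p). if \<epsilon> then Direct i 1 True p else Detour i 1 False p) ` (UNIV \<times> {0..n - i})"
    unfolding pairs_image using assms
    by (cases b) (simp_all add: basis_between_def basis_def le_diff_conv2 max_def ex_bool_eq, auto)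
qed

lemma basis_between_1_1:
  assumes "1 \<le> n"
  shows "basis_between n 1 1 = (\<lambda>p. Detour 1 1 False p) ` {0..n - 1}"
proof (rule Set.set_eqI)
  fix b
  show "b \<in> basis_between n 1 1 \<longleftrightarrow> b \<in> (\<lambda>p. Detour 1 1 False p) ` {0..n - 1}"
    using assms by (cases b) (simp_all add: basis_between_def basis_def le_diff_conv2 image_iff, auto)
qed

lemma sum_bideg_ge_2:
  assumes "i \<in> {2..n}" "j \<in> {2..n}"
  shows "(\<Sum>b\<in>basis_between n i j. Poly_Mapping.single (bideg b) 1) =
    (t_pow (nat \<bar>int i - int j\<bar>) * s_pow (of_int \<bar>int i - int j\<bar> / 2)
     + t_pow (i + j - 2) * s_pow ((of_nat i + of_nat j - 4) / 2))
    * (1 + s_pow 1) * (\<Sum>p = 0..n - max i j. s_pow (of_nat p) * t_pow (2 * p))"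
proof -
  have t: "nat \<bar>int i - int j\<bar> = i - j + (j - i)" "i + j - 2 = (i - 1) + (j - 1)"
    using assms by auto
  have s: "of_int \<bar>int i - int j\<bar> / 2 = (of_nat ((i - max 2 j) + (max 2 j - i)) / 2 :: rat)"
    "(of_nat i + of_nat j - 4) / 2 = (of_nat ((i - 2) + (j - 2)) / 2 :: rat)"
    using assms by (cases "i \<le> j"; simp add: of_nat_diff max_def)+
  show ?thesis
    unfolding basis_between_ge_2[OF assms] ts_monom(1) distrib_right series_expand t s
    by (subst sum.union_disjoint) (auto simp: sum_image_pairs inj_def)
qed

lemma sum_bideg_1_left:
  assumes "j \<in> {2..n}"
  shows "(\<Sum>b\<in>basis_between n 1 j. Poly_Mapping.single (bideg b) 1) =
    t_pow (j - 1) * s_pow ((of_nat j - 2) / 2) * (1 + s_pow 1)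
    * (\<Sum>p = 0..n - j. s_pow (of_nat p) * t_pow (2 * p))"
proof -
  have s: "(of_nat j - 2) / 2 = (of_nat (j - 2) / 2 :: rat)" using assms by (simp add: of_nat_diff)
  show ?thesis
    unfolding basis_between_1_left[OF assms] ts_monom(1) series_expand s
    by (subst sum_image_pairs) (simp_all add: inj_def)
qed

lemma sum_bideg_1_right:
  assumes "i \<in> {2..n}"
  shows "(\<Sum>b\<in>basis_between n i 1. Poly_Mapping.single (bideg b) 1) =
    t_pow (i - 1) * s_pow ((of_nat i - 2) / 2) * (1 + s_pow 1)
    * (\<Sum>p = 0..n - i. s_pow (of_nat p) * t_pow (2 * p))"
proof -
  have s: "(of_nat i - 2) / 2 = (of_nat (i - 2) / 2 :: rat)" using assms by (simp add: of_nat_diff)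
  have inj: "inj (\<lambda>(\<epsilon>, p). if \<epsilon> then Direct i 1 True p else Detour i 1 False p)"
    by (auto simp: inj_def split: if_splits)
  show ?thesis
    unfolding basis_between_1_right[OF assms] ts_monom(1) series_expand s sum_image_pairs[OF inj]
    using assms by (simp add: UNIV_bool of_nat_diff max_def)
qed

lemma sum_bideg_1_1:
  assumes "1 \<le> n"
  shows "(\<Sum>b\<in>basis_between n 1 1. Poly_Mapping.single (bideg b) 1) =
    (\<Sum>p = 0..n - 1. s_pow (of_nat p) * t_pow (2 * p))"
  unfolding basis_between_1_1[OF assms] ts_monom by (subst sum.reindex) (auto simp: inj_on_def)

theorem corollary5p18:
  fixes n :: nat
  assumes "n \<ge> 2"
  shows
    "(\<forall>i\<in>{2..n}. \<forall>j\<in>{2..n}.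
        has_hilbert_series n (corner n i j :: 'k::field Pi_elt set)
          (Poly_Mapping.lookup
            ((t_pow (nat \<bar>int i - int j\<bar>) * s_pow (of_int \<bar>int i - int j\<bar> / 2)
              + t_pow (i + j - 2) * s_pow ((of_nat i + of_nat j - 4) / 2))
             * (1 + s_pow 1)
             * (\<Sum>p = 0..n - max i j. s_pow (of_nat p) * t_pow (2 * p)))))
   \<and> (\<forall>j\<in>{2..n}.
        has_hilbert_series n (corner n 1 j :: 'k Pi_elt set)
          (Poly_Mapping.lookup
            (t_pow (j - 1) * s_pow ((of_nat j - 2) / 2) * (1 + s_pow 1)
             * (\<Sum>p = 0..n - j. s_pow (of_nat p) * t_pow (2 * p))))
      \<and> has_hilbert_series n (corner n j 1 :: 'k Pi_elt set)
          (Poly_Mapping.lookup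
            (t_pow (j - 1) * s_pow ((of_nat j - 2) / 2) * (1 + s_pow 1)
             * (\<Sum>p = 0..n - j. s_pow (of_nat p) * t_pow (2 * p)))))
   \<and> has_hilbert_series n (corner n 1 1 :: 'k Pi_elt set)
        (Poly_Mapping.lookup (\<Sum>p = 0..n - 1. s_pow (of_nat p) * t_pow (2 * p)))"
proof (intro conjI ballI, goal_cases)
  case (1 i j)
  then show ?case
    using has_hilbert_series_corner[OF assms, of i j] by (simp add: sum_bideg_ge_2)
next
  case (2 j)
  then show ?case
    using has_hilbert_series_corner[OF assms, of 1 j] assms by (simp add: sum_bideg_1_left)
next
  case (3 j)
  then show ?case
    using has_hilbert_series_corner[OF assms, of j 1] assms by (simp add: sum_bideg_1_right)
next
  case 4
  show ?case
    using has_hilbert_series_corner[OF assms, of 1 1] assms by (simp add: sum_bideg_1_1)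
qed

end
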